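(* Let $G$ be a CERS. Then $G$ is regular if and only if the resonance graph $R(G)$ is a daisy cube.
   Context: An even ring system is a simple bipartite 2-connected plane graph with all interior vertices of degree 3 and all boundary vertices of degree 2 or 3. The inner dual is the graph on the inner faces, two faces adjacent iff they share an edge. A CERS (catacondensed even ring system) is an even ring system whose inner dual is a tree. The resonance graph $R(G)$ has as vertices the perfect matchings of $G$, with $M_1\sim M_2$ iff $M_1\oplus M_2$ is exactly the edge set of one inner face. If $F,F',F''$ are inner faces such that $F,F'$ share an edge $e$ and $F',F''$ share an edge $f$ (with $F\neq F''$), $(F,F',F'')$ is an adjacent triple of faces; it is regular if $d_G(e,f)$ is even and irregular otherwise, where the distance between two edges is the distance between the corresponding vertices of the line graph of $G$. A CERS is regular if it has at most two inner faces or every adjacent triple of faces is regular. For $B=\{0,1\}$ order $B^n$ by $u\le v$ iff $u_i\le v_i$ for all $i$. For $X\subseteq B^n$, $Q_n(X)$ is the subgraph of the hypercube $Q_n$ induced by $\{u\in B^n: u\le x \text{ for some } x\in X\}$; a graph is a daisy cube if it is isomorphic to $Q_n(X)$ for some $n$ and $X\subseteq B^n$. *)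

theory Defs
  imports Main
begin

section \<open>Finite simple graphs (edges are 2-element vertex sets)\<close>

definition simple_graph :: "'v set \<Rightarrow> 'v set set \<Rightarrow> bool" where
  "simple_graph V E \<longleftrightarrow> finite V \<and>
     (\<forall>e\<in>E. \<exists>u v. e = {u, v} \<and> u \<in> V \<and> v \<in> V \<and> u \<noteq> v)"

definition neighbours :: "'v set set \<Rightarrow> 'v \<Rightarrow> 'v set" where
  "neighbours E v = {u. {u, v} \<in> E}"

definition degree :: "'v set set \<Rightarrow> 'v \<Rightarrow> nat" where
  "degree E v = card {e\<in>E. v \<in> e}"

text \<open>Connectivity of the subgraph induced by a vertex set W.\<close>
definition connected_on :: "'v set \<Rightarrow> 'v set set \<Rightarrow> bool" where
  "connected_on W E \<longleftrightarrow>
     (\<forall>u\<in>W. \<forall>w\<in>W. (u, w) \<in> {(a, b). a \<in> W \<and> b \<in> W \<and> {a, b} \<in> E}\<^sup>*)"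

definition two_connected :: "'v set \<Rightarrow> 'v set set \<Rightarrow> bool" where
  "two_connected V E \<longleftrightarrow> card V \<ge> 3 \<and> connected_on V E \<and>
     (\<forall>v\<in>V. connected_on (V - {v}) E)"

definition bipartite :: "'v set \<Rightarrow> 'v set set \<Rightarrow> bool" where
  "bipartite V E \<longleftrightarrow> (\<exists>A. \<forall>e\<in>E. card (e \<inter> A) = 1)"

section \<open>Plane graphs as combinatorial maps (rotation systems) of genus 0 with an outer face\<close>

text \<open>rot v is a cyclic permutation of the neighbours of v (the clockwise order around v).\<close>
definition rotation_system :: "'v set \<Rightarrow> 'v set set \<Rightarrow> ('v \<Rightarrow> 'v \<Rightarrow> 'v) \<Rightarrow> bool" where
  "rotation_system V E rot \<longleftrightarrow>
     (\<forall>v\<in>V. bij_betw (rot v) (neighbours E v) (neighbours E v) \<and>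
        (\<forall>u\<in>neighbours E v. \<forall>w\<in>neighbours E v. \<exists>k. (rot v ^^ k) u = w))"

definition darts :: "'v set set \<Rightarrow> ('v \<times> 'v) set" where
  "darts E = {(u, v). {u, v} \<in> E}"

text \<open>Face-tracing permutation on darts.\<close>
definition face_step :: "('v \<Rightarrow> 'v \<Rightarrow> 'v) \<Rightarrow> 'v \<times> 'v \<Rightarrow> 'v \<times> 'v" where
  "face_step rot d = (snd d, rot (snd d) (fst d))"

definition face_orbit :: "('v \<Rightarrow> 'v \<Rightarrow> 'v) \<Rightarrow> 'v \<times> 'v \<Rightarrow> ('v \<times> 'v) set" where
  "face_orbit rot d = {(face_step rot ^^ k) d | k. True}"

definition faces :: "'v set set \<Rightarrow> ('v \<Rightarrow> 'v \<Rightarrow> 'v) \<Rightarrow> ('v \<times> 'v) set set" where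
  "faces E rot = face_orbit rot ` darts E"

definition face_edges :: "('v \<times> 'v) set \<Rightarrow> 'v set set" where
  "face_edges F = {{u, v} | u v. (u, v) \<in> F}"

definition face_vertices :: "('v \<times> 'v) set \<Rightarrow> 'v set" where
  "face_vertices F = fst ` F"

text \<open>A plane graph: connected simple graph with a genus-0 rotation system (Euler's formula)
  and a designated outer face fo.\<close>
definition plane_graph ::
  "'v set \<Rightarrow> 'v set set \<Rightarrow> ('v \<Rightarrow> 'v \<Rightarrow> 'v) \<Rightarrow> ('v \<times> 'v) set \<Rightarrow> bool" where
  "plane_graph V E rot fo \<longleftrightarrow> simple_graph V E \<and> connected_on V E \<and>
     rotation_system V E rot \<and>
     int (card V) - int (card E) + int (card (faces E rot)) = 2 \<and>
     fo \<in> faces E rot"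

definition inner_faces :: "'v set set \<Rightarrow> ('v \<Rightarrow> 'v \<Rightarrow> 'v) \<Rightarrow> ('v \<times> 'v) set \<Rightarrow> ('v \<times> 'v) set set" where
  "inner_faces E rot fo = faces E rot - {fo}"

section \<open>Even ring systems and CERS\<close>

definition even_ring_system ::
  "'v set \<Rightarrow> 'v set set \<Rightarrow> ('v \<Rightarrow> 'v \<Rightarrow> 'v) \<Rightarrow> ('v \<times> 'v) set \<Rightarrow> bool" where
  "even_ring_system V E rot fo \<longleftrightarrow> plane_graph V E rot fo \<and> bipartite V E \<and> two_connected V E \<and>
     (\<forall>v\<in>V - face_vertices fo. degree E v = 3) \<and>
     (\<forall>v\<in>V \<inter> face_vertices fo. degree E v = 2 \<or> degree E v = 3)"

text \<open>Inner dual adjacency: distinct inner faces sharing an edge.\<close>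
definition inner_dual_adj ::
  "'v set set \<Rightarrow> ('v \<Rightarrow> 'v \<Rightarrow> 'v) \<Rightarrow> ('v \<times> 'v) set \<Rightarrow> ('v \<times> 'v) set \<Rightarrow> ('v \<times> 'v) set \<Rightarrow> bool" where
  "inner_dual_adj E rot fo F F' \<longleftrightarrow> F \<in> inner_faces E rot fo \<and> F' \<in> inner_faces E rot fo \<and>
     F \<noteq> F' \<and> face_edges F \<inter> face_edges F' \<noteq> {}"

text \<open>A (finite) graph given by vertex set W and adjacency relation adj is a tree:
  connected and without cycles.\<close>
definition is_tree :: "'a set \<Rightarrow> ('a \<Rightarrow> 'a \<Rightarrow> bool) \<Rightarrow> bool" where
  "is_tree W adj \<longleftrightarrow> W \<noteq> {} \<and>
     (\<forall>u\<in>W. \<forall>w\<in>W. (u, w) \<in> {(a, b). a \<in> W \<and> b \<in> W \<and> adj a b}\<^sup>*) \<and>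
     \<not> (\<exists>cs. length cs \<ge> 3 \<and> distinct cs \<and> set cs \<subseteq> W \<and>
          (\<forall>i < length cs - 1. adj (cs ! i) (cs ! Suc i)) \<and> adj (last cs) (hd cs))"

definition CERS ::
  "'v set \<Rightarrow> 'v set set \<Rightarrow> ('v \<Rightarrow> 'v \<Rightarrow> 'v) \<Rightarrow> ('v \<times> 'v) set \<Rightarrow> bool" where
  "CERS V E rot fo \<longleftrightarrow> even_ring_system V E rot fo \<and>
     is_tree (inner_faces E rot fo) (inner_dual_adj E rot fo)"

section \<open>Regularity\<close>

definition line_adj :: "'v set set \<Rightarrow> 'v set \<Rightarrow> 'v set \<Rightarrow> bool" where
  "line_adj E e f \<longleftrightarrow> e \<in> E \<and> f \<in> E \<and> e \<noteq> f \<and> e \<inter> f \<noteq> {}"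

text \<open>Distance between two edges = distance in the line graph.\<close>
definition edge_dist :: "'v set set \<Rightarrow> 'v set \<Rightarrow> 'v set \<Rightarrow> nat" where
  "edge_dist E e f = (LEAST n. (e, f) \<in> {(a, b). line_adj E a b} ^^ n)"

definition regular_CERS ::
  "'v set \<Rightarrow> 'v set set \<Rightarrow> ('v \<Rightarrow> 'v \<Rightarrow> 'v) \<Rightarrow> ('v \<times> 'v) set \<Rightarrow> bool" where
  "regular_CERS V E rot fo \<longleftrightarrow> card (inner_faces E rot fo) \<le> 2 \<or>
     (\<forall>F F' F'' e f. F \<in> inner_faces E rot fo \<and> F' \<in> inner_faces E rot fo \<and>
        F'' \<in> inner_faces E rot fo \<and> F \<noteq> F' \<and> F' \<noteq> F'' \<and> F \<noteq> F'' \<and>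
        e \<in> face_edges F \<inter> face_edges F' \<and> f \<in> face_edges F' \<inter> face_edges F''
        \<longrightarrow> even (edge_dist E e f))"

section \<open>Perfect matchings and the resonance graph\<close>

definition perfect_matchings :: "'v set \<Rightarrow> 'v set set \<Rightarrow> 'v set set set" where
  "perfect_matchings V E = {M. M \<subseteq> E \<and> (\<forall>v\<in>V. \<exists>!e. e \<in> M \<and> v \<in> e)}"

definition resonance_adj ::
  "'v set \<Rightarrow> 'v set set \<Rightarrow> ('v \<Rightarrow> 'v \<Rightarrow> 'v) \<Rightarrow> ('v \<times> 'v) set \<Rightarrow> 'v set set \<Rightarrow> 'v set set \<Rightarrow> bool" where
  "resonance_adj V E rot fo M1 M2 \<longleftrightarrow>
     M1 \<in> perfect_matchings V E \<and> M2 \<in> perfect_matchings V E \<and>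
     (\<exists>F\<in>inner_faces E rot fo. (M1 - M2) \<union> (M2 - M1) = face_edges F)"

section \<open>Daisy cubes\<close>

text \<open>B^n as boolean lists of length n, ordered componentwise.\<close>
definition bvec_le :: "bool list \<Rightarrow> bool list \<Rightarrow> bool" where
  "bvec_le u v \<longleftrightarrow> length u = length v \<and> (\<forall>i < length u. u ! i \<longrightarrow> v ! i)"

definition daisy_vertices :: "nat \<Rightarrow> bool list set \<Rightarrow> bool list set" where
  "daisy_vertices n X = {u. length u = n \<and> (\<exists>x\<in>X. bvec_le u x)}"

definition hypercube_adj :: "bool list \<Rightarrow> bool list \<Rightarrow> bool" where
  "hypercube_adj u v \<longleftrightarrow> length u = length v \<and> card {i. i < length u \<and> u ! i \<noteq> v ! i} = 1"

text \<open>The graph (W, adj) is isomorphic to Q_n(X) for some n and X \<subseteq> B^n.\<close>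
definition daisy_cube :: "'a set \<Rightarrow> ('a \<Rightarrow> 'a \<Rightarrow> bool) \<Rightarrow> bool" where
  "daisy_cube W adj \<longleftrightarrow> (\<exists>n X f. X \<subseteq> {x. length x = n} \<and>
     bij_betw f W (daisy_vertices n X) \<and>
     (\<forall>a\<in>W. \<forall>b\<in>W. adj a b \<longleftrightarrow> hypercube_adj (f a) (f b)))"

end

theory Submission
  imports Defs
begin

text \<open>
  Euler's formula, used through complementary spanning trees of the graph and its dual, shows that
  no edge has the same face on both sides and that two outer edges of an inner face form a cut. As
  all degrees are at most 3 and the inner dual has no triangle, all vertices lie on the outer face,
  the edges shared by inner faces are pairwise disjoint, and counting them gives an ordering of the
  inner faces in which each new face meets the earlier ones in exactly one edge.

  The edges of each (even) face split into two alternating classes, and the distance of two of its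
  edges is even iff they lie in the same class. In the regular case all shared edges of a face lie
  in one class, and mapping a perfect matching to the set of faces whose other class it contains
  identifies the resonance graph with the independent sets of the inner dual, which are closed under
  subsets. Conversely, if the resonance graph is a daisy cube, the matching at its bottom vertex is
  alternating on every inner face. It then contains every shared edge, so that all shared edges of a
  face lie in the same class.
\<close>

section \<open>Connectivity and orderings\<close>

text \<open>The plane is given only by a rotation system, so no curve is available to separate
  anything: every separation statement has to come from counting. The same concerns the tree
  hypothesis. \<open>inner_dual_adj\<close> forgets multiplicities and \<open>is_tree\<close>
  excludes only cycles of at least three faces, so the definitions alone do not forbid two inner
  faces from sharing several edges; this follows from the count |S| + 1 = |IF|. Outer edges carry
  the bookkeeping. Every inner face has one, it lies on no other inner face, and two outer edges of
  one face are flipped together, so the flip of a face can be read off a single edge. This makes the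
  map from matchings to sets of faces well defined, and it shows that opposite edges of a square in
  the resonance graph flip the same face. In a daisy cube such squares lead from any edge down to
  the bottom vertex, because coordinates may be reset freely.\<close>

text \<open>Connectivity in terms of cuts. This form directly supplies the next element of a greedy
  ordering, and its failure directly supplies the vertex set of a cut.\<close>

definition linked :: "'a set \<Rightarrow> ('a \<Rightarrow> 'a \<Rightarrow> bool) \<Rightarrow> bool" where
  "linked W R \<longleftrightarrow> (\<forall>C. C \<subseteq> W \<longrightarrow> C \<noteq> {} \<longrightarrow> C \<noteq> W \<longrightarrow> (\<exists>a\<in>C. \<exists>b\<in>W - C. R a b))"

lemma linked_if_rtrancl:
  assumes "\<forall>u\<in>W. \<forall>w\<in>W. (u, w) \<in> {(a, b). a \<in> W \<and> b \<in> W \<and> R a b}\<^sup>*"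
  shows "linked W R"
  unfolding linked_def
proof (intro allI impI)
  fix C assume C: "C \<subseteq> W" "C \<noteq> {}" "C \<noteq> W"
  then obtain u w where u: "u \<in> C" and w: "w \<in> W" "w \<notin> C" by blast
  show "\<exists>a\<in>C. \<exists>b\<in>W - C. R a b"
  proof (rule ccontr)
    assume no: "\<not> ?thesis"
    have "(u, w) \<in> {(a, b). a \<in> W \<and> b \<in> W \<and> R a b}\<^sup>*"
      using assms C u w by blast
    then have "w \<in> C"
      by (induction rule: rtrancl_induct) (use u no in auto)
    with w show False by simp
  qed
qed

text \<open>Greedy extension: the cut between listed and remaining elements supplies the next one.
  The prefix \<open>ys\<close> is kept arbitrary so that one or two elements can be prescribed at
  the start.\<close>

lemma linked_ordering:
  assumes "finite W" "linked W R" "ys \<noteq> []" "distinct ys" "set ys \<subseteq> W"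
    and "\<And>j. 0 < j \<Longrightarrow> j < length ys \<Longrightarrow> \<exists>i<j. R (ys ! i) (ys ! j)"
  shows "\<exists>zs. distinct (ys @ zs) \<and> set (ys @ zs) = W \<and>
    (\<forall>j. 0 < j \<longrightarrow> j < length (ys @ zs) \<longrightarrow> (\<exists>i<j. R ((ys @ zs) ! i) ((ys @ zs) ! j)))"
  using assms(3-)
proof (induction "card (W - set ys)" arbitrary: ys rule: less_induct)
  case less
  show ?case
  proof (cases "set ys = W")
    case True
    then show ?thesis using less.prems by (intro exI[of _ "[]"]) auto
  next
    case False
    with less.prems assms(2) obtain a b where ab: "a \<in> set ys" "b \<in> W - set ys" "R a b"
      unfolding linked_def by (metis set_empty)
    let ?ys = "ys @ [b]"
    have less': "card (W - set ?ys) < card (W - set ys)"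
      using ab assms(1) by (intro psubset_card_mono) auto
    have step: "\<exists>i<j. R (?ys ! i) (?ys ! j)" if "0 < j" "j < length ?ys" for j
    proof (cases "j < length ys")
      case True
      with less.prems(4)[OF that(1) True] show ?thesis
        by (metis (mono_tags, lifting) less_trans nth_append)
    next
      case False
      with that have "j = length ys" by simp
      moreover obtain i where "i < length ys" "ys ! i = a" using ab by (metis in_set_conv_nth)
      ultimately show ?thesis using ab by (intro exI[of _ i]) (auto simp: nth_append)
    qed
    have "\<exists>zs. distinct (?ys @ zs) \<and> set (?ys @ zs) = W \<and>
      (\<forall>j. 0 < j \<longrightarrow> j < length (?ys @ zs) \<longrightarrow> (\<exists>i<j. R ((?ys @ zs) ! i) ((?ys @ zs) ! j)))"
      by (rule less.hyps[OF less']) (use less.prems ab step in auto)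
    then obtain zs where "distinct (?ys @ zs) \<and> set (?ys @ zs) = W \<and>
      (\<forall>j. 0 < j \<longrightarrow> j < length (?ys @ zs) \<longrightarrow> (\<exists>i<j. R ((?ys @ zs) ! i) ((?ys @ zs) ! j)))"
      by blast
    then show ?thesis by (intro exI[of _ "b # zs"]) simp
  qed
qed

text \<open>The element at position j is attached to some earlier element by the edge g j; the edge g 0 is
  meaningless.\<close>
definition attach_order :: "('a \<Rightarrow> 'e \<Rightarrow> bool) \<Rightarrow> 'a list \<Rightarrow> (nat \<Rightarrow> 'e) \<Rightarrow> bool" where
  "attach_order inc xs g \<longleftrightarrow> distinct xs \<and>
     (\<forall>j. 0 < j \<longrightarrow> j < length xs \<longrightarrow> (\<exists>i<j. inc (xs ! i) (g j)) \<and> inc (xs ! j) (g j))"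

lemma attach_orderD:
  assumes "attach_order inc xs g"
  shows "distinct xs"
    and "0 < j \<Longrightarrow> j < length xs \<Longrightarrow> \<exists>i<j. inc (xs ! i) (g j)"
    and "0 < j \<Longrightarrow> j < length xs \<Longrightarrow> inc (xs ! j) (g j)"
  using assms unfolding attach_order_def by blast+

text \<open>An edge has room for two elements only, and \<open>g j\<close> is already filled by
  \<open>xs ! j\<close> and an earlier one. This is what allows an ordering to be dismantled from
  its end.\<close>

lemma attach_order_last:
  assumes "attach_order inc xs g"
    and two: "\<And>a b c e. inc a e \<Longrightarrow> inc b e \<Longrightarrow> inc c e \<Longrightarrow> a = b \<or> a = c \<or> b = c"
    and "0 < j" "j < length xs" "l < length xs" "inc (xs ! l) (g j)"
  shows "l \<le> j"
proof (rule ccontr)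
  assume "\<not> l \<le> j"
  moreover obtain i where "i < j" "inc (xs ! i) (g j)"
    using attach_orderD(2)[OF assms(1)] assms by blast
  moreover have "inc (xs ! j) (g j)" using attach_orderD(3)[OF assms(1)] assms by blast
  ultimately show False
    using two[of "xs ! i" "g j" "xs ! j" "xs ! l"] attach_orderD(1)[OF assms(1)] assms
    by (auto simp: nth_eq_iff_index_eq)
qed

lemma attach_order_inj:
  assumes "attach_order inc xs g"
    and "\<And>a b c e. inc a e \<Longrightarrow> inc b e \<Longrightarrow> inc c e \<Longrightarrow> a = b \<or> a = c \<or> b = c"
  shows "inj_on g {1..<length xs}"
proof (rule inj_onI)
  fix j l assume jl: "j \<in> {1..<length xs}" "l \<in> {1..<length xs}" "g j = g l"
  have "l \<le> j"
    using jl attach_orderD(3)[OF assms(1), of l] by (intro attach_order_last[OF assms]) auto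
  moreover have "j \<le> l"
    using jl attach_orderD(3)[OF assms(1), of j] by (intro attach_order_last[OF assms]) auto
  ultimately show "j = l" by simp
qed

lemma attach_order_exists:
  assumes "finite W" "linked W (\<lambda>a b. \<exists>e\<in>E. inc a e \<and> inc b e)" "x \<in> W"
  obtains xs g where "set xs = W" "xs \<noteq> []" "hd xs = x" "attach_order inc xs g"
    "g ` {1..<length xs} \<subseteq> E"
proof -
  obtain zs where zs: "distinct ([x] @ zs)" "set ([x] @ zs) = W"
    and ord: "\<And>j. 0 < j \<Longrightarrow> j < length ([x] @ zs) \<Longrightarrow>
      \<exists>i<j. \<exists>e\<in>E. inc (([x] @ zs) ! i) e \<and> inc (([x] @ zs) ! j) e"
    using linked_ordering[OF assms(1,2), of "[x]"] assms(3) by auto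
  define xs where "xs = [x] @ zs"
  have "\<forall>j. \<exists>e. 0 < j \<longrightarrow> j < length xs \<longrightarrow> e \<in> E \<and> (\<exists>i<j. inc (xs ! i) e) \<and> inc (xs ! j) e"
    using ord unfolding xs_def by blast
  then obtain g where g: "\<And>j. 0 < j \<Longrightarrow> j < length xs \<Longrightarrow>
      g j \<in> E \<and> (\<exists>i<j. inc (xs ! i) (g j)) \<and> inc (xs ! j) (g j)"
    by metis
  show ?thesis
  proof (rule that[of xs g])
    show "attach_order inc xs g" using g zs unfolding attach_order_def xs_def by blast
    show "g ` {1..<length xs} \<subseteq> E" using g by auto
  qed (use zs in \<open>auto simp: xs_def\<close>)
qed

lemma attach_order_exists2:
  assumes "finite W" "linked W (\<lambda>a b. \<exists>e\<in>E. inc a e \<and> inc b e)" "x \<in> W" "y \<in> W" "x \<noteq> y"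
    "e \<in> E" "inc x e" "inc y e"
  obtains zs g where "set (x # y # zs) = W" "attach_order inc (x # y # zs) g"
    "g ` {1..<length (x # y # zs)} \<subseteq> E" "g 1 = e"
proof -
  have "\<exists>zs. distinct ([x, y] @ zs) \<and> set ([x, y] @ zs) = W \<and>
    (\<forall>j. 0 < j \<longrightarrow> j < length ([x, y] @ zs) \<longrightarrow>
      (\<exists>i<j. \<exists>e\<in>E. inc (([x, y] @ zs) ! i) e \<and> inc (([x, y] @ zs) ! j) e))"
    by (rule linked_ordering[OF assms(1,2)])
      (use assms in \<open>auto simp: less_Suc_eq nth_Cons' split: if_splits\<close>)
  then obtain zs where zs: "distinct (x # y # zs)" "set (x # y # zs) = W"
    and ord: "\<And>j. 0 < j \<Longrightarrow> j < length (x # y # zs) \<Longrightarrow>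
      \<exists>i<j. \<exists>e\<in>E. inc ((x # y # zs) ! i) e \<and> inc ((x # y # zs) ! j) e"
    by auto
  define xs where "xs = x # y # zs"
  have "\<forall>j. \<exists>e. 0 < j \<longrightarrow> j < length xs \<longrightarrow> e \<in> E \<and> (\<exists>i<j. inc (xs ! i) e) \<and> inc (xs ! j) e"
    using ord unfolding xs_def by blast
  then obtain h where h: "\<And>j. 0 < j \<Longrightarrow> j < length xs \<Longrightarrow>
      h j \<in> E \<and> (\<exists>i<j. inc (xs ! i) (h j)) \<and> inc (xs ! j) (h j)"
    by metis
  \<comment> \<open>The ordering promises only some edge between x and y; the prescribed one
    replaces it.\<close>
  define g where "g = h(1 := e)"
  have g: "g j \<in> E \<and> (\<exists>i<j. inc (xs ! i) (g j)) \<and> inc (xs ! j) (g j)"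
    if "0 < j" "j < length xs" for j
  proof (cases "j = 1")
    case True
    then show ?thesis using assms by (auto simp: g_def xs_def)
  next
    case False
    then show ?thesis using h[OF that] by (simp add: g_def)
  qed
  show ?thesis
  proof (rule that[of zs g])
    show "attach_order inc (x # y # zs) g"
      using g zs unfolding attach_order_def xs_def by blast
    show "g ` {1..<length (x # y # zs)} \<subseteq> E" using g unfolding xs_def by auto
  qed (use zs in \<open>auto simp: g_def\<close>)
qed

text \<open>A greedy ordering attaches every vertex except the first to an earlier one, and these
  attaching edges are distinct because each determines its later end.\<close>

lemma card_le_edges_if_linked:
  assumes "finite V" "finite E" "linked V (\<lambda>a b. {a, b} \<in> E)"
  shows "card V \<le> card E + 1"
proof (cases "V = {}")
  case False
  then obtain x where x: "x \<in> V" by blast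
  obtain zs where zs: "distinct ([x] @ zs)" "set ([x] @ zs) = V"
    and ord: "\<And>j. 0 < j \<Longrightarrow> j < length ([x] @ zs) \<Longrightarrow>
      \<exists>i<j. {([x] @ zs) ! i, ([x] @ zs) ! j} \<in> E"
    using linked_ordering[OF assms(1,3), of "[x]"] x by auto
  define xs where "xs = [x] @ zs"
  obtain p where p: "\<And>j. 0 < j \<Longrightarrow> j < length xs \<Longrightarrow> p j < j \<and> {xs ! p j, xs ! j} \<in> E"
    using ord unfolding xs_def by metis
  have dist: "distinct xs" using zs by (simp add: xs_def)
  have "inj_on (\<lambda>j. {xs ! p j, xs ! j}) {1..<length xs}"
  proof (rule inj_onI)
    fix j l assume jl: "j \<in> {1..<length xs}" "l \<in> {1..<length xs}"
      and eq: "{xs ! p j, xs ! j} = {xs ! p l, xs ! l}"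
    have "p j < j" "p l < l" using p jl by auto
    moreover have "j = p l \<or> j = l"
      using eq jl \<open>p l < l\<close> dist by (auto simp: doubleton_eq_iff nth_eq_iff_index_eq)
    moreover have "l = p j \<or> j = l"
      using eq jl \<open>p j < j\<close> dist by (auto simp: doubleton_eq_iff nth_eq_iff_index_eq)
    ultimately show "j = l" by auto
  qed
  moreover have "(\<lambda>j. {xs ! p j, xs ! j}) ` {1..<length xs} \<subseteq> E" using p by auto
  ultimately have "card {1..<length xs} \<le> card E" using assms(2) by (rule card_inj_on_le)
  moreover have "card V = length xs" using zs distinct_card[of xs] by (simp add: xs_def)
  ultimately show ?thesis by simp
qed simp


section \<open>Faces of a combinatorial map\<close>

locale combinatorial_map =
  fixes V :: "'v set" and E :: "'v set set" and rot :: "'v \<Rightarrow> 'v \<Rightarrow> 'v"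
  assumes simple: "simple_graph V E" and rots: "rotation_system V E rot"
begin

abbreviation "step \<equiv> face_step rot"
abbreviation "orb \<equiv> face_orbit rot"
abbreviation "D \<equiv> darts E"
abbreviation "FS \<equiv> faces E rot"

text \<open>Membership in \<open>FS\<close> is part of incidence, so that \<open>inc_two\<close>
  needs no side conditions.\<close>

definition inc :: "('v \<times> 'v) set \<Rightarrow> 'v set \<Rightarrow> bool" where
  "inc F e \<longleftrightarrow> F \<in> FS \<and> e \<in> face_edges F"

definition cut :: "'v set \<Rightarrow> 'v set set" where
  "cut W = {e \<in> E. \<exists>a b. e = {a, b} \<and> a \<in> W \<and> b \<notin> W}"

lemma finite_V: "finite V" using simple by (simp add: simple_graph_def)

lemma edgeD: "{u, v} \<in> E \<Longrightarrow> u \<in> V \<and> v \<in> V \<and> u \<noteq> v"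
  using simple unfolding simple_graph_def by (metis doubleton_eq_iff)

lemma edgeE:
  assumes "e \<in> E" obtains u v where "e = {u, v}" "u \<in> V" "v \<in> V" "u \<noteq> v"
  using assms simple unfolding simple_graph_def by blast

lemma finite_E: "finite E"
proof (rule finite_subset)
  show "E \<subseteq> Pow V" using edgeE by blast
qed (simp add: finite_V)

lemma dart_iff: "(u, v) \<in> D \<longleftrightarrow> {u, v} \<in> E" by (simp add: darts_def)

lemma dart_sym: "(u, v) \<in> D \<longleftrightarrow> (v, u) \<in> D" by (simp add: darts_def insert_commute)

lemma finite_D: "finite D"
proof (rule finite_subset)
  show "D \<subseteq> V \<times> V" using edgeD by (auto simp: darts_def)
qed (simp add: finite_V)

lemma nbr_iff: "u \<in> neighbours E v \<longleftrightarrow> (v, u) \<in> D"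
  by (simp add: neighbours_def darts_def insert_commute)

lemma rot_bij: "v \<in> V \<Longrightarrow> bij_betw (rot v) (neighbours E v) (neighbours E v)"
  using rots by (simp add: rotation_system_def)

lemma rot_dart: "(v, u) \<in> D \<Longrightarrow> (v, rot v u) \<in> D"
  using rot_bij[of v] edgeD[of v u] by (auto simp: nbr_iff[symmetric] dart_iff[symmetric] bij_betw_def)

lemma rot_inj: "(v, u) \<in> D \<Longrightarrow> (v, w) \<in> D \<Longrightarrow> rot v u = rot v w \<Longrightarrow> u = w"
  using rot_bij[of v] edgeD[of v u]
  by (auto simp: nbr_iff[symmetric] dart_iff[symmetric] bij_betw_def inj_on_def)

lemma rot_transitive: "(v, u) \<in> D \<Longrightarrow> (v, w) \<in> D \<Longrightarrow> \<exists>k. (rot v ^^ k) u = w"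
  using rots edgeD[of v u] by (auto simp: rotation_system_def nbr_iff dart_iff)

lemma step_simp [simp]: "step (u, v) = (v, rot v u)" by (simp add: face_step_def)

lemma step_dart: "d \<in> D \<Longrightarrow> step d \<in> D"
  by (cases d) (simp add: rot_dart dart_sym)

lemma step_inj: "inj_on step D"
proof (rule inj_onI)
  fix d d' assume d: "d \<in> D" "d' \<in> D" "step d = step d'"
  obtain u v w where "d = (u, v)" "d' = (w, v)" "rot v u = rot v w"
    using d(3) by (cases d, cases d') simp
  then show "d = d'" using d(1,2) rot_inj[of v u w] dart_sym by simp
qed

lemma funpow_dart: "d \<in> D \<Longrightarrow> (step ^^ k) d \<in> D"
  by (induction k) (auto simp: step_dart)

lemma funpow_step_inj: "d \<in> D \<Longrightarrow> d' \<in> D \<Longrightarrow> (step ^^ k) d = (step ^^ k) d' \<Longrightarrow> d = d'"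
proof (induction k)
  case (Suc k)
  then show ?case using step_inj funpow_dart by (auto simp: inj_on_def)
qed simp

lemma period_exists:
  assumes "d \<in> D" shows "\<exists>p>0. (step ^^ p) d = d"
proof -
  have "\<not> inj_on (\<lambda>k. (step ^^ k) d) UNIV"
  proof
    assume "inj_on (\<lambda>k. (step ^^ k) d) UNIV"
    moreover have "finite (range (\<lambda>k. (step ^^ k) d))"
      by (rule finite_subset[OF _ finite_D]) (use funpow_dart[OF assms] in blast)
    ultimately show False using finite_imageD infinite_UNIV_nat by blast
  qed
  then obtain i j where "i \<noteq> j" "(step ^^ i) d = (step ^^ j) d"
    by (auto simp: inj_on_def)
  then obtain i j where ij: "i < j" "(step ^^ i) d = (step ^^ j) d"
    by (metis linorder_neqE_nat)
  have "(step ^^ i) d = (step ^^ i) ((step ^^ (j - i)) d)"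
    using ij by (simp flip: funpow_add comp_apply[of "step ^^ i"])
  then have "d = (step ^^ (j - i)) d" by (rule funpow_step_inj[rotated 2]) (use assms funpow_dart in auto)
  with ij show ?thesis by (intro exI[of _ "j - i"]) auto
qed

lemma orb_self: "d \<in> orb d" unfolding face_orbit_def by (auto intro: exI[of _ 0])

lemma orb_step: "d' \<in> orb d \<Longrightarrow> step d' \<in> orb d"
  unfolding face_orbit_def by clarsimp (metis comp_apply funpow.simps(2))

lemma orb_funpow: "(step ^^ k) d \<in> orb d" unfolding face_orbit_def by blast

lemma orb_D: "d \<in> D \<Longrightarrow> orb d \<subseteq> D" unfolding face_orbit_def using funpow_dart by blast

lemma orb_sub: "d' \<in> orb d \<Longrightarrow> orb d' \<subseteq> orb d"
  unfolding face_orbit_def by (auto simp flip: funpow_add comp_apply[of "step ^^ _"])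

lemma orb_sym:
  assumes "d \<in> D" "d' \<in> orb d" shows "d \<in> orb d'"
proof -
  obtain k where k: "d' = (step ^^ k) d" using assms by (auto simp: face_orbit_def)
  obtain p where p: "p > 0" "(step ^^ p) d = d" using period_exists assms by blast
  have "(step ^^ (p * k)) d = d"
  proof (induction k)
    case (Suc k)
    have "(step ^^ (p * Suc k)) d = (step ^^ p) ((step ^^ (p * k)) d)" by (simp add: funpow_add)
    then show ?case using Suc p by simp
  qed simp
  moreover have "p * k = (p * k - k) + k" using p by (cases p) auto
  ultimately have "(step ^^ (p * k - k)) d' = d" unfolding k
    by (metis comp_apply funpow_add)
  then show ?thesis by (metis orb_funpow)
qed

lemma orb_eq: "d \<in> D \<Longrightarrow> d' \<in> orb d \<Longrightarrow> orb d' = orb d"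
  using orb_sub orb_sym by blast

lemma orb_face: "d \<in> D \<Longrightarrow> orb d \<in> FS" by (simp add: faces_def)

lemma face_D: "F \<in> FS \<Longrightarrow> d \<in> F \<Longrightarrow> d \<in> D"
  unfolding faces_def using orb_D by blast

lemma face_eq_orb: "F \<in> FS \<Longrightarrow> d \<in> F \<Longrightarrow> F = orb d"
  unfolding faces_def using orb_eq by blast

lemma face_unique: "F \<in> FS \<Longrightarrow> F' \<in> FS \<Longrightarrow> d \<in> F \<Longrightarrow> d \<in> F' \<Longrightarrow> F = F'"
  using face_eq_orb by metis

lemma face_step_in: "F \<in> FS \<Longrightarrow> d \<in> F \<Longrightarrow> step d \<in> F"
  using face_eq_orb orb_step orb_self by metis

lemma face_nonempty: "F \<in> FS \<Longrightarrow> F \<noteq> {}" unfolding faces_def using orb_self by blast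

lemma face_has_dart: assumes "F \<in> FS" obtains v u where "(v, u) \<in> F"
  using face_nonempty[OF assms] by (metis ex_in_conv surj_pair)

lemma finite_face: "F \<in> FS \<Longrightarrow> finite F"
  using face_D finite_D by (meson finite_subset subsetI)

lemma finite_FS: "finite FS" by (simp add: faces_def finite_D)

lemma step_bij_face:
  assumes "F \<in> FS" shows "bij_betw step F F"
proof -
  have "inj_on step F" using step_inj face_D[OF assms] by (auto simp: inj_on_def)
  moreover have "step ` F \<subseteq> F" using face_step_in assms by blast
  ultimately show ?thesis using endo_inj_surj finite_face[OF assms] by (simp add: bij_betw_def)
qed

lemma face_in_dart:
  assumes "F \<in> FS" "(v, a) \<in> F"
  obtains b where "(b, v) \<in> F" "a = rot v b"
proof -
  obtain d where "d \<in> F" "step d = (v, a)"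
    using step_bij_face[OF assms(1)] assms(2) by (metis bij_betw_def imageE)
  then show ?thesis using that[of "fst d"] by (cases d) auto
qed

lemma face_out_dart: "F \<in> FS \<Longrightarrow> (u, v) \<in> F \<Longrightarrow> (v, rot v u) \<in> F"
  using face_step_in by fastforce

lemma face_vertices_iff_out: "v \<in> face_vertices F \<longleftrightarrow> (\<exists>a. (v, a) \<in> F)"
  by (force simp: face_vertices_def)

lemma face_vertices_out: "(v, a) \<in> F \<Longrightarrow> v \<in> face_vertices F"
  by (force simp: face_vertices_def)

lemma face_vertices_in: "F \<in> FS \<Longrightarrow> (u, v) \<in> F \<Longrightarrow> v \<in> face_vertices F"
  using face_out_dart face_vertices_out by metis

lemma face_edges_iff: "{u, v} \<in> face_edges F \<longleftrightarrow> (u, v) \<in> F \<or> (v, u) \<in> F"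
  by (auto simp: face_edges_def doubleton_eq_iff)

lemma face_edgesE:
  assumes "e \<in> face_edges F" obtains u v where "e = {u, v}" "(u, v) \<in> F"
  using assms unfolding face_edges_def by blast

lemma face_edges_sub: "F \<in> FS \<Longrightarrow> face_edges F \<subseteq> E"
  unfolding face_edges_def using face_D dart_iff by blast

lemma face_edges_vertices:
  assumes "F \<in> FS" "e \<in> face_edges F" "v \<in> e" shows "v \<in> face_vertices F"
proof -
  obtain u w where uw: "e = {u, w}" "(u, w) \<in> F" using assms(2) by (rule face_edgesE)
  show ?thesis
    using face_vertices_in[OF assms(1) uw(2)] face_vertices_out[OF uw(2)] uw(1) assms(3) by auto
qed

lemma inc_iff: "{u, v} \<in> E \<Longrightarrow> inc F {u, v} \<longleftrightarrow> F = orb (u, v) \<or> F = orb (v, u)"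
proof -
  assume "{u, v} \<in> E"
  then have "(u, v) \<in> D" "(v, u) \<in> D" using dart_iff dart_sym by blast+
  then show ?thesis unfolding inc_def face_edges_iff
    using face_eq_orb[of F "(u, v)"] face_eq_orb[of F "(v, u)"] orb_face orb_self by blast
qed

lemma inc_E: "inc F e \<Longrightarrow> e \<in> E" unfolding inc_def using face_edges_sub by blast

lemma inc_two: "inc a e \<Longrightarrow> inc b e \<Longrightarrow> inc c e \<Longrightarrow> a = b \<or> a = c \<or> b = c"
proof -
  assume inc: "inc a e" "inc b e" "inc c e"
  obtain u v where e: "e = {u, v}" using edgeE inc_E[OF inc(1)] by blast
  show ?thesis using inc inc_E[OF inc(1)] inc_iff unfolding e by auto
qed

section \<open>Cuts and complementary dual trees\<close>

text \<open>\<open>step\<close> maps the darts of F ending in W bijectively onto those starting in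
  W; discarding the darts inside W leaves the claim. Darts are counted rather than edges because at
  this stage a face may still traverse an edge in both directions.\<close>

lemma balance:
  assumes "F \<in> FS"
  shows "card {d \<in> F. fst d \<in> W \<and> snd d \<notin> W} = card {d \<in> F. fst d \<notin> W \<and> snd d \<in> W}"
proof -
  have fin: "finite F" using finite_face assms by blast
  have "step ` {d \<in> F. snd d \<in> W} = {d \<in> F. fst d \<in> W}"
  proof -
    have "step ` F = F" using step_bij_face[OF assms] by (simp add: bij_betw_def)
    then show ?thesis by (force simp: face_step_def image_iff set_eq_iff)
  qed
  moreover have "inj_on step {d \<in> F. snd d \<in> W}"
    using step_bij_face[OF assms] by (auto simp: bij_betw_def inj_on_def)
  ultimately have "card {d \<in> F. fst d \<in> W} = card {d \<in> F. snd d \<in> W}"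
    using card_image[of step "{d \<in> F. snd d \<in> W}"] by simp
  moreover have "card {d \<in> F. fst d \<in> W} =
      card {d \<in> F. fst d \<in> W \<and> snd d \<in> W} + card {d \<in> F. fst d \<in> W \<and> snd d \<notin> W}"
  proof -
    have "{d \<in> F. fst d \<in> W} =
        {d \<in> F. fst d \<in> W \<and> snd d \<in> W} \<union> {d \<in> F. fst d \<in> W \<and> snd d \<notin> W}" by blast
    then show ?thesis using fin by (simp add: card_Un_disjoint disjoint_iff)
  qed
  moreover have "card {d \<in> F. snd d \<in> W} =
      card {d \<in> F. fst d \<in> W \<and> snd d \<in> W} + card {d \<in> F. fst d \<notin> W \<and> snd d \<in> W}"
  proof -
    have "{d \<in> F. snd d \<in> W} =
        {d \<in> F. fst d \<in> W \<and> snd d \<in> W} \<union> {d \<in> F. fst d \<notin> W \<and> snd d \<in> W}" by blast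
    then show ?thesis using fin by (simp add: card_Un_disjoint disjoint_iff)
  qed
  ultimately show ?thesis by simp
qed

lemma cut_iff: "{a, b} \<in> cut W \<longleftrightarrow> {a, b} \<in> E \<and> (a \<in> W \<longleftrightarrow> b \<notin> W)"
  by (auto simp: cut_def doubleton_eq_iff)

lemma cutE:
  assumes "e \<in> cut W" obtains a b where "e = {a, b}" "a \<in> W" "b \<notin> W" "{a, b} \<in> E"
  using assms unfolding cut_def by blast

text \<open>Induction from the last position downwards. On the face at position j, edges
  \<open>g l\<close> with l < j do not occur, those with l > j are already known to be outside the
  cut, and \<open>y\<close> is absent, so \<open>g j\<close> would be the only cut edge,
  contradicting \<open>balance\<close>. From position \<open>J\<close> on the faces avoid
  \<open>y\<close>.\<close>

lemma cut_peel:
  assumes ord: "attach_order inc fs g" and fs: "set fs = FS"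
    and sub: "cut W \<subseteq> insert y (g ` {1..<length fs})" and J: "1 \<le> J"
    and y: "\<And>j. J \<le> j \<Longrightarrow> j < length fs \<Longrightarrow> y \<notin> face_edges (fs ! j)"
  shows "cut W \<subseteq> insert y (g ` {1..<J})"
proof -
  have "J \<le> j \<Longrightarrow> j < length fs \<Longrightarrow> g j \<notin> cut W" for j
  proof (induction "length fs - j" arbitrary: j rule: less_induct)
    case less
    define F where "F = fs ! j"
    have FF: "F \<in> FS" using less fs by (auto simp: F_def)
    have only: "e = g j" if e: "e \<in> cut W" "e \<in> face_edges F" for e
    proof -
      have "e \<noteq> y" using y less.prems that by (auto simp: F_def)
      then obtain l where l: "l \<in> {1..<length fs}" "e = g l" using e sub by blast
      have "j \<le> l"
        by (rule attach_order_last[OF ord inc_two])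
          (use l less.prems that FF in \<open>auto simp: inc_def F_def\<close>)
      moreover have "\<not> j < l"
        using less.hyps[of l] less.prems l that by (auto simp: diff_less_mono2)
      ultimately show ?thesis using l by simp
    qed
    show ?case
    proof
      assume cj: "g j \<in> cut W"
      then obtain a b where ab: "g j = {a, b}" "a \<in> W" "b \<notin> W" "{a, b} \<in> E" by (auto simp: cut_def)
      obtain i where i: "i < j" "inc (fs ! i) (g j)" "inc F (g j)"
        using attach_orderD(2,3)[OF ord, of j] less.prems J by (auto simp: F_def)
      have "F \<noteq> fs ! i"
        using attach_orderD(1)[OF ord] i less.prems by (auto simp: F_def nth_eq_iff_index_eq)
      \<comment> \<open>The other dart of \<open>g j\<close> belongs to the earlier face
        \<open>fs ! i\<close>, so exactly one of the two lies on F.\<close>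
      then have one: "(a, b) \<in> F \<longleftrightarrow> (b, a) \<notin> F"
        using i FF ab by (metis face_eq_orb inc_def inc_iff face_edges_iff)
      have out: "d = (a, b)" if "d \<in> F" "fst d \<in> W" "snd d \<notin> W" for d
        using only[of "{fst d, snd d}"] that ab face_D[OF FF, of d]
        by (cases d) (auto simp: cut_iff face_edges_iff doubleton_eq_iff dart_iff)
      have inn: "d = (b, a)" if "d \<in> F" "fst d \<notin> W" "snd d \<in> W" for d
        using only[of "{fst d, snd d}"] that ab face_D[OF FF, of d]
        by (cases d) (auto simp: cut_iff face_edges_iff doubleton_eq_iff dart_iff)
      let ?out = "{d \<in> F. fst d \<in> W \<and> snd d \<notin> W}" and ?inn = "{d \<in> F. fst d \<notin> W \<and> snd d \<in> W}"
      have fin: "finite ?out" "finite ?inn" using finite_face[OF FF] by simp_all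
      show False
      proof (cases "(a, b) \<in> F")
        case True
        then have "(a, b) \<in> ?out" using ab by simp
        then have "?out \<noteq> {}" by blast
        then have "card ?out \<noteq> 0" unfolding card_0_eq[OF fin(1)] .
        moreover have "?inn = {}" using inn one True by blast
        ultimately show False using balance[OF FF, of W] by (simp only: card.empty)
      next
        case False
        then have "(b, a) \<in> ?inn" using ab one by simp
        then have "?inn \<noteq> {}" by blast
        then have "card ?inn \<noteq> 0" unfolding card_0_eq[OF fin(2)] .
        moreover have "?out = {}" using out False by blast
        ultimately show False using balance[OF FF, of W] by (simp only: card.empty)
      qed
    qed
  qed
  then have lt: "j < J" if "j < length fs" "g j \<in> cut W" for j
    using that not_le[of J j] by blast
  show ?thesis
  proof
    fix e assume e: "e \<in> cut W"
    show "e \<in> insert y (g ` {1..<J})"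
    proof (cases "e = y")
      case False
      then obtain j where "j \<in> {1..<length fs}" "e = g j" using e sub by blast
      then show ?thesis using lt[of j] e by simp
    qed simp
  qed
qed

text \<open>The tree edges and \<open>y\<close> together number |FS|, so by Euler's formula |V| - 2
  edges remain, one too few to connect V. A disconnecting set has its whole cut among the removed
  edges, and connectivity of the full graph makes this cut nonempty.\<close>

lemma euler_cut:
  assumes "linked V (\<lambda>a b. {a, b} \<in> E)"
    and euler: "int (card V) - int (card E) + int (card FS) = 2"
    and ord: "attach_order inc fs g" and fs: "set fs = FS" "fs \<noteq> []"
    and g: "g ` {1..<length fs} \<subseteq> E" and y: "y \<in> E" "y \<notin> g ` {1..<length fs}"
  shows "\<exists>W. cut W \<noteq> {} \<and> cut W \<subseteq> insert y (g ` {1..<length fs})"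
proof -
  let ?T = "insert y (g ` {1..<length fs})"
  have "length fs = card FS"
    using attach_orderD(1)[OF ord] fs distinct_card by metis
  moreover have "card (g ` {1..<length fs}) = length fs - 1"
    using card_image[OF attach_order_inj[OF ord inc_two]] by simp
  ultimately have cT: "card ?T = card FS"
    using fs(2) y(2) by (cases fs) (simp_all add: card_insert_if)
  have TE: "?T \<subseteq> E" using g y by auto
  then have "card (E - ?T) = card E - card FS" "card FS \<le> card E"
    using cT finite_E card_Diff_subset[of ?T E] card_mono[of E ?T] finite_subset by metis+
  then have "\<not> card V \<le> card (E - ?T) + 1" using euler by linarith
  then have "\<not> linked V (\<lambda>a b. {a, b} \<in> E - ?T)"
    using card_le_edges_if_linked finite_V finite_E by blast
  then obtain C where C: "C \<subseteq> V" "C \<noteq> {}" "C \<noteq> V"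
    and no: "\<And>a b. a \<in> C \<Longrightarrow> b \<in> V - C \<Longrightarrow> {a, b} \<notin> E - ?T"
    unfolding linked_def by blast
  obtain a b where ab: "a \<in> C" "b \<in> V - C" "{a, b} \<in> E"
    using assms(1) C unfolding linked_def by blast
  show ?thesis
  proof (intro exI[of _ C] conjI)
    show "cut C \<noteq> {}" using ab cut_iff[of a b C] by auto
    show "cut C \<subseteq> ?T"
      using no edgeD by (fastforce simp: cut_def)
  qed
qed

text \<open>The darts of a set of faces closed under adjacency are closed under reversal, hence
  under rotation, which is a reversal followed by a face step. They fill up every vertex they touch,
  and connectivity of the graph carries them everywhere.\<close>

lemma faces_linked:
  assumes conn: "linked V (\<lambda>a b. {a, b} \<in> E)"
  shows "linked FS (\<lambda>F F'. \<exists>e\<in>E. inc F e \<and> inc F' e)"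
  unfolding linked_def
proof (intro allI impI)
  fix C assume C: "C \<subseteq> FS" "C \<noteq> {}" "C \<noteq> FS"
  show "\<exists>a\<in>C. \<exists>b\<in>FS - C. \<exists>e\<in>E. inc a e \<and> inc b e"
  proof (rule ccontr)
    assume no: "\<not> ?thesis"
    have rev: "(v, u) \<in> \<Union>C" if uv: "(u, v) \<in> \<Union>C" for u v
    proof -
      obtain F where F: "F \<in> C" "(u, v) \<in> F" using uv by auto
      have uvD: "(u, v) \<in> D" using F C face_D by blast
      then have "inc F {u, v}" "inc (orb (v, u)) {u, v}" "{u, v} \<in> E" "orb (v, u) \<in> FS"
        using F C by (auto simp: inc_def face_edges_iff dart_sym orb_face orb_self dart_iff insert_commute)
      then have "orb (v, u) \<in> C" using no F by blast
      then show ?thesis using orb_self by blast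
    qed
    have rotC: "(v, rot v u) \<in> \<Union>C" if "(v, u) \<in> \<Union>C" for u v
      using rev[OF that] face_out_dart C by blast
    have powC: "(v, (rot v ^^ k) u) \<in> \<Union>C" if "(v, u) \<in> \<Union>C" for u v k
    proof (induction k)
      case (Suc k)
      then show ?case using rotC[of v "(rot v ^^ k) u"] by simp
    qed (use that in simp)
    have CD: "\<Union>C \<subseteq> D" using C face_D by blast
    have all: "(v, w) \<in> \<Union>C" if vu: "(v, u) \<in> \<Union>C" and vw: "(v, w) \<in> D" for u v w
    proof -
      obtain k where "(rot v ^^ k) u = w" using rot_transitive vu vw CD by blast
      then show ?thesis using powC[OF vu, of k] by simp
    qed
    define U where "U = {v \<in> V. \<exists>u. (v, u) \<in> \<Union>C}"
    obtain F where F: "F \<in> C" using C by blast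
    then obtain v u where vu: "(v, u) \<in> F" using C(1) face_has_dart by blast
    then have "v \<in> V" using CD F edgeD[of v u] dart_iff[of v u] by blast
    then have "v \<in> U" using F vu unfolding U_def by blast
    have "U = V"
    proof (rule ccontr)
      assume "U \<noteq> V"
      then obtain a b where ab: "a \<in> U" "b \<in> V - U" "{a, b} \<in> E"
        using conn[unfolded linked_def, rule_format, of U] \<open>v \<in> U\<close> U_def by blast
      then obtain u where "(a, u) \<in> \<Union>C" unfolding U_def by blast
      then have "(b, a) \<in> \<Union>C" using rev all ab(3) dart_iff by blast
      then have "b \<in> U" using ab(2) unfolding U_def by blast
      with ab show False by simp
    qed
    have "FS \<subseteq> C"
    proof
      fix F assume F: "F \<in> FS"
      then obtain v w where vw: "(v, w) \<in> F" using face_has_dart by blast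
      then have vwD: "(v, w) \<in> D" using face_D F by blast
      then have "v \<in> U" using \<open>U = V\<close> edgeD[of v w] by (simp add: dart_iff)
      then obtain u where "(v, u) \<in> \<Union>C" unfolding U_def by blast
      then have "(v, w) \<in> \<Union>C" using all vwD by blast
      then show "F \<in> C" using face_unique[of F] F vw C by blast
    qed
    with C show False by blast
  qed
qed

end

section \<open>Catacondensed even ring systems\<close>

locale cers = combinatorial_map V E rot
  for V :: "'v set" and E :: "'v set set" and rot :: "'v \<Rightarrow> 'v \<Rightarrow> 'v" +
  fixes fo :: "('v \<times> 'v) set"
  assumes cers: "CERS V E rot fo"
begin

abbreviation "IF \<equiv> inner_faces E rot fo"

lemma ers: "even_ring_system V E rot fo" using cers by (simp add: CERS_def)

lemma plane: "plane_graph V E rot fo" using ers by (simp add: even_ring_system_def)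

lemma two_conn: "two_connected V E" using ers by (simp add: even_ring_system_def)

lemma conn: "linked V (\<lambda>a b. {a, b} \<in> E)"
  using plane by (intro linked_if_rtrancl) (simp add: plane_graph_def connected_on_def)

lemma euler: "int (card V) - int (card E) + int (card FS) = 2"
  using plane by (simp add: plane_graph_def)

lemma fo_FS: "fo \<in> FS" using plane by (simp add: plane_graph_def)

lemma IF_iff: "F \<in> IF \<longleftrightarrow> F \<in> FS \<and> F \<noteq> fo" by (simp add: inner_faces_def)

lemma IF_FS: "F \<in> IF \<Longrightarrow> F \<in> FS" by (simp add: IF_iff)

lemma card_V: "3 \<le> card V" using two_conn by (simp add: two_connected_def)

lemma conn_delete: "v \<in> V \<Longrightarrow> linked (V - {v}) (\<lambda>a b. {a, b} \<in> E)"
  using two_conn by (intro linked_if_rtrancl) (simp add: two_connected_def connected_on_def)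

lemma inner_linked: "linked IF (inner_dual_adj E rot fo)"
  using cers by (intro linked_if_rtrancl) (simp add: CERS_def is_tree_def)

lemma no_triangle:
  assumes "inner_dual_adj E rot fo A B" "inner_dual_adj E rot fo B C" "inner_dual_adj E rot fo C A"
  shows False
proof -
  have "A \<in> IF" "B \<in> IF" "C \<in> IF" "A \<noteq> B" "B \<noteq> C" "C \<noteq> A"
    using assms by (simp_all add: inner_dual_adj_def)
  then have "length [A, B, C] \<ge> 3 \<and> distinct [A, B, C] \<and> set [A, B, C] \<subseteq> IF \<and>
      (\<forall>i < length [A, B, C] - 1. inner_dual_adj E rot fo ([A, B, C] ! i) ([A, B, C] ! Suc i)) \<and>
      inner_dual_adj E rot fo (last [A, B, C]) (hd [A, B, C])"
    using assms by (auto simp: less_Suc_eq numeral_2_eq_2)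
  moreover have "is_tree IF (inner_dual_adj E rot fo)" using cers by (simp add: CERS_def)
  ultimately show False unfolding is_tree_def by blast
qed

text \<open>One end of the edge would be a cut vertex: the end in W, unless W contains no other
  vertex, and then the end outside, where |V| \<ge> 3 supplies a third vertex.\<close>

lemma no_bridge: "cut W \<noteq> {y}"
proof
  assume y: "cut W = {y}"
  then have "y \<in> cut W" by simp
  then obtain a b where ab: "y = {a, b}" "a \<in> W" "b \<notin> W" "{a, b} \<in> E"
    by (rule cutE)
  have abV: "a \<in> V" "b \<in> V" using edgeD[OF ab(4)] by auto
  show False
  proof (cases "W \<inter> V = {a}")
    case False
    have "\<exists>p\<in>W \<inter> V - {a}. \<exists>q\<in>V - {a} - (W \<inter> V - {a}). {p, q} \<in> E"
      using conn_delete[OF abV(1)] unfolding linked_def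
      by (elim allE[of _ "W \<inter> V - {a}"] impE) (use False ab abV in blast)+
    then obtain p q where pq: "p \<in> W" "p \<noteq> a" "q \<notin> W" "{p, q} \<in> E" by blast
    then have "{p, q} \<in> cut W" by (simp add: cut_iff)
    then show False using y ab pq by (auto simp: doubleton_eq_iff)
  next
    case True
    have "V - {b} \<noteq> {a}"
    proof
      assume "V - {b} = {a}"
      then have "V \<subseteq> {a, b}" by blast
      then have "card V \<le> card {a, b}" by (intro card_mono) auto
      also have "\<dots> \<le> 2" by (simp add: card_insert_if)
      finally show False using card_V by simp
    qed
    then have "\<exists>p\<in>{a}. \<exists>q\<in>V - {b} - {a}. {p, q} \<in> E"
      using conn_delete[OF abV(2)] unfolding linked_def
      by (elim allE[of _ "{a}"] impE) (use ab abV in blast)+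
    then obtain q where q: "q \<in> V" "q \<noteq> b" "q \<noteq> a" "{a, q} \<in> E" by blast
    moreover have "q \<notin> W" using True q by blast
    ultimately have "{a, q} \<in> cut W" using ab by (simp add: cut_iff)
    then show False using y ab q by (auto simp: doubleton_eq_iff)
  qed
qed

text \<open>A dual spanning tree together with one further dual edge leaves too few primal edges for a
  connected graph, so some cut lies inside it; the balance of cut darts over each face then
  peels the tree edges off this cut, starting from the leaves.\<close>
lemma no_loop:
  assumes "(u, v) \<in> D" shows "orb (u, v) \<noteq> orb (v, u)"
proof
  define F where "F = orb (u, v)"
  assume "orb (u, v) = orb (v, u)"
  then have only: "inc F' {u, v} \<Longrightarrow> F' = F" for F'
    using assms by (auto simp: F_def dart_iff inc_iff)
  have F: "F \<in> FS" using assms orb_face by (simp add: F_def)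
  obtain fs g where fs: "set fs = FS" "fs \<noteq> []" "hd fs = F" "attach_order inc fs g"
    "g ` {1..<length fs} \<subseteq> E"
    using attach_order_exists[OF finite_FS faces_linked[OF conn] F] by metis
  have notinc: "\<not> inc (fs ! j) {u, v}" if "1 \<le> j" "j < length fs" for j
  proof
    assume "inc (fs ! j) {u, v}"
    then have "fs ! j = fs ! 0" using only fs by (simp add: hd_conv_nth)
    then show False using nth_eq_iff_index_eq[OF attach_orderD(1)[OF fs(4)], of j 0] fs(2) that by auto
  qed
  have notin: "{u, v} \<notin> g ` {1..<length fs}"
  proof
    assume "{u, v} \<in> g ` {1..<length fs}"
    then obtain j where "j \<in> {1..<length fs}" "{u, v} = g j" by blast
    then show False using attach_orderD(3)[OF fs(4), of j] notinc[of j] by simp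
  qed
  obtain W where W: "cut W \<noteq> {}" "cut W \<subseteq> insert {u, v} (g ` {1..<length fs})"
    using euler_cut[OF conn euler fs(4,1,2,5) _ notin] assms by (auto simp: dart_iff)
  \<comment> \<open>Only the first face carries the edge, so the whole tree is peeled off and a
    one-edge cut remains.\<close>
  have "cut W \<subseteq> insert {u, v} (g ` {1..<1})"
  proof (rule cut_peel[OF fs(4,1) W(2)])
    fix j assume j: "1 \<le> j" "j < length fs"
    then have "fs ! j \<in> FS" using fs(1) nth_mem by blast
    then show "{u, v} \<notin> face_edges (fs ! j)" using notinc[OF j] by (simp add: inc_def)
  qed simp
  then have "cut W = {{u, v}}" using W(1) by auto
  then show False using no_bridge by blast
qed

text \<open>The dual tree starts with \<open>fo\<close>, F and the tree edge x. Since y joins the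
  same two faces, peeling reaches down to position 2 and leaves a nonempty part of {x, y};
  \<open>no_bridge\<close> excludes a single edge.\<close>

lemma two_cut:
  assumes F: "F \<in> IF" and x: "x \<in> face_edges F" "x \<in> face_edges fo"
    and y: "y \<in> face_edges F" "y \<in> face_edges fo" and xy: "x \<noteq> y"
  shows "\<exists>W. cut W = {x, y}"
proof -
  have inc: "inc fo x" "inc F x" "inc fo y" "inc F y"
    using F x y fo_FS by (auto simp: inc_def IF_iff)
  have xE: "x \<in> E" and yE: "y \<in> E" using inc inc_E by blast+
  have Ffo: "fo \<noteq> F" "F \<in> FS" using F by (auto simp: IF_iff)
  obtain zs g where fs: "set (fo # F # zs) = FS" "attach_order inc (fo # F # zs) g"
    "g ` {1..<length (fo # F # zs)} \<subseteq> E" "g 1 = x"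
    using attach_order_exists2[OF finite_FS faces_linked[OF conn] fo_FS Ffo(2,1) xE inc(1,2)]
    by metis
  define fs where "fs = fo # F # zs"
  have fs: "set fs = FS" "attach_order inc fs g" "g ` {1..<length fs} \<subseteq> E" "g 1 = x" "fs \<noteq> []"
    using fs unfolding fs_def by simp_all
  have notinc: "\<not> inc (fs ! j) y" if j: "2 \<le> j" "j < length fs" for j
  proof
    assume "inc (fs ! j) y"
    then have "fs ! j = fs ! 0 \<or> fs ! j = fs ! 1"
      using inc_two[OF inc(3,4), of "fs ! j"] Ffo by (auto simp: fs_def)
    moreover have "fs ! j \<noteq> fs ! i" if "i < 2" for i
      using nth_eq_iff_index_eq[OF attach_orderD(1)[OF fs(2)], of j i] that j by simp
    ultimately show False by auto
  qed
  have notin: "y \<notin> g ` {1..<length fs}"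
  proof
    assume "y \<in> g ` {1..<length fs}"
    then obtain j where j: "j \<in> {1..<length fs}" "y = g j" by blast
    then have "j \<noteq> 1" using xy fs(4) by auto
    then show False using attach_orderD(3)[OF fs(2), of j] notinc[of j] j by simp
  qed
  obtain W where W: "cut W \<noteq> {}" "cut W \<subseteq> insert y (g ` {1..<length fs})"
    using euler_cut[OF conn euler fs(2,1,5,3) yE notin] by blast
  have "cut W \<subseteq> insert y (g ` {1..<2})"
  proof (rule cut_peel[OF fs(2,1) W(2)])
    fix j assume j: "2 \<le> j" "j < length fs"
    then have "fs ! j \<in> FS" using fs(1) nth_mem by blast
    then show "y \<notin> face_edges (fs ! j)" using notinc[OF j] by (simp add: inc_def)
  qed simp
  moreover have "g ` {1..<2} = {x}" using fs(4) by (simp add: numeral_2_eq_2)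
  ultimately have "cut W \<subseteq> {x, y}" by auto
  then have "cut W = {x, y}" using W(1) no_bridge[of W x] no_bridge[of W y] by auto
  then show ?thesis by blast
qed

section \<open>Rotations and faces at vertices of degree at most three\<close>

lemma finite_nbrs: "finite (neighbours E v)"
proof (rule finite_subset)
  show "neighbours E v \<subseteq> snd ` D" by (force simp: nbr_iff)
qed (simp add: finite_D)

lemma degree_nbrs: "degree E v = card (neighbours E v)"
proof -
  have "{e \<in> E. v \<in> e} = (\<lambda>u. {u, v}) ` neighbours E v"
  proof (intro set_eqI iffI)
    fix e assume "e \<in> {e \<in> E. v \<in> e}"
    then have e: "e \<in> E" "v \<in> e" by auto
    then obtain a b where "e = {a, b}" using edgeE by metis
    then have "e = {a, v} \<or> e = {b, v}" using e by auto
    then show "e \<in> (\<lambda>u. {u, v}) ` neighbours E v" using e by (auto simp: neighbours_def)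
  qed (auto simp: neighbours_def)
  moreover have "inj_on (\<lambda>u. {u, v}) (neighbours E v)"
    by (auto simp: inj_on_def doubleton_eq_iff)
  ultimately show ?thesis by (simp add: degree_def card_image)
qed

lemma card_nbrs_cases:
  assumes "v \<in> V"
  shows "card (neighbours E v) = 3 \<or> (card (neighbours E v) = 2 \<and> v \<in> face_vertices fo)"
  using ers assms by (cases "v \<in> face_vertices fo") (auto simp: even_ring_system_def degree_nbrs)

lemma card_nbrs_le: "v \<in> V \<Longrightarrow> card (neighbours E v) \<le> 3"
  using card_nbrs_cases[of v] by auto

text \<open>The degree bound in the form used below: naming four different neighbours is a
  contradiction.\<close>

lemma nbrs_le:
  assumes "v \<in> V" "set xs \<subseteq> neighbours E v" "distinct xs"
  shows "length xs \<le> 3"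
  using card_mono[OF finite_nbrs assms(2)] card_nbrs_le[OF assms(1)] distinct_card[OF assms(3)]
  by simp

lemma orb_rot: "(v, u) \<in> D \<Longrightarrow> orb (v, rot v u) = orb (u, v)"
  using orb_eq[of "(u, v)" "(v, rot v u)"] orb_step[OF orb_self, of "(u, v)"] dart_sym[of u v]
  by simp

lemma rot_neq: "(v, u) \<in> D \<Longrightarrow> rot v u \<noteq> u"
  using orb_rot[of v u] no_loop[of v u] by metis

text \<open>Otherwise u, w and their images under the rotation would be four distinct neighbours.
  Degree at most 3 is exploited in this form: any two faces at a vertex are next to each other
  there.\<close>

lemma rot_next:
  assumes "(v, u) \<in> D" "(v, w) \<in> D" "u \<noteq> w"
  shows "w = rot v u \<or> u = rot v w"
proof (rule ccontr)
  assume no: "\<not> ?thesis"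
  have vV: "v \<in> V" using assms(1) edgeD[of v u] by (simp add: dart_iff)
  have "rot v u \<noteq> rot v w" using rot_inj[OF assms(1,2)] assms(3) by auto
  then have "length [u, w, rot v u, rot v w] \<le> 3"
    using no assms rot_neq[OF assms(1)] rot_neq[OF assms(2)] rot_dart[OF assms(1)] rot_dart[OF assms(2)]
    by (intro nbrs_le[OF vV]) (auto simp: nbr_iff)
  then show False by simp
qed

text \<open>Of two consecutive outgoing darts, one lies in the face of the reversal of the other. As
  a consequence, a face visits each vertex at most once.\<close>

lemma out_faces: "(v, u) \<in> D \<Longrightarrow> (v, w) \<in> D \<Longrightarrow> u \<noteq> w \<Longrightarrow> orb (v, u) \<noteq> orb (v, w)"
  using rot_next[of v u w] orb_rot[of v u] orb_rot[of v w] no_loop[of v u] no_loop[of v w] by metis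

lemma face_out_unique: "F \<in> FS \<Longrightarrow> (v, u) \<in> F \<Longrightarrow> (v, w) \<in> F \<Longrightarrow> u = w"
  using out_faces[of v u w] face_eq_orb[of F "(v, u)"] face_eq_orb[of F "(v, w)"]
    face_D[of F "(v, u)"] face_D[of F "(v, w)"] by auto

lemma face_in_unique: "F \<in> FS \<Longrightarrow> (u, v) \<in> F \<Longrightarrow> (w, v) \<in> F \<Longrightarrow> u = w"
  using face_out_dart[of F u v] face_out_dart[of F w v] face_out_unique[of F v]
    rot_inj[of v u w] face_D[of F "(u, v)"] face_D[of F "(w, v)"] dart_sym[of u v] dart_sym[of w v]
  by blast

lemma face_no_rev: "F \<in> FS \<Longrightarrow> (u, v) \<in> F \<Longrightarrow> (v, u) \<notin> F"
  using no_loop[of u v] face_eq_orb[of F "(u, v)"] face_eq_orb[of F "(v, u)"] face_D[of F "(u, v)"]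
  by auto

lemma adj_rot:
  assumes "(v, u) \<in> D" "orb (v, u) \<in> IF" "orb (v, rot v u) \<in> IF"
  shows "inner_dual_adj E rot fo (orb (v, u)) (orb (v, rot v u))"
proof -
  have "orb (v, u) \<noteq> orb (v, rot v u)" using orb_rot no_loop assms(1) by metis
  moreover have "{v, u} \<in> face_edges (orb (v, u))" "{v, u} \<in> face_edges (orb (v, rot v u))"
    using orb_self[of "(v, u)"] orb_self[of "(u, v)"] orb_rot[OF assms(1)]
    by (simp_all add: face_edges_iff)
  ultimately show ?thesis using assms by (auto simp: inner_dual_adj_def)
qed

lemma on_outer:
  assumes v: "v \<in> V" shows "v \<in> face_vertices fo"
proof (rule ccontr)
  assume no: "v \<notin> face_vertices fo"
  then have c3: "card (neighbours E v) = 3" using card_nbrs_cases v by blast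
  then obtain u where u: "(v, u) \<in> D" using nbr_iff by (metis card.empty ex_in_conv zero_neq_numeral)
  define u1 u2 where "u1 = rot v u" and "u2 = rot v u1"
  have u1: "(v, u1) \<in> D" and u2: "(v, u2) \<in> D" using u rot_dart by (simp_all add: u1_def u2_def)
  have ne: "u \<noteq> u1" "u1 \<noteq> u2" using rot_neq[OF u] rot_neq[OF u1] by (simp_all add: u1_def u2_def)
  \<comment> \<open>If the rotation swapped \<open>u\<close> and \<open>u1\<close>, a third
    neighbour would have to be mapped to \<open>u\<close> as well, against injectivity.\<close>
  have "u2 \<noteq> u"
  proof
    assume eq: "u2 = u"
    have "\<exists>w. w \<in> neighbours E v \<and> w \<notin> {u, u1}"
    proof (rule ccontr)
      assume "\<not> ?thesis"
      then have "neighbours E v \<subseteq> {u, u1}" by blast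
      then have "card (neighbours E v) \<le> card {u, u1}" by (intro card_mono) auto
      then show False using c3 by (simp add: card_insert_if split: if_splits)
    qed
    then obtain w where w: "(v, w) \<in> D" "w \<noteq> u" "w \<noteq> u1" by (auto simp: nbr_iff)
    then have "rot v w = rot v u1" using rot_next[OF u w(1)] eq by (auto simp: u1_def u2_def)
    then show False using rot_inj[OF w(1) u1] w by blast
  qed
  then have cyc: "rot v u2 = u" using rot_next[OF u u2] ne by (auto simp: u1_def)
  have inner: "orb (v, w) \<in> IF" if "(v, w) \<in> D" for w
    using that no face_vertices_out[of v w] orb_self[of "(v, w)"] orb_face by (auto simp: IF_iff)
  have "inner_dual_adj E rot fo (orb (v, u)) (orb (v, u1))"
    using adj_rot[OF u inner[OF u]] inner[OF u1] by (simp flip: u1_def)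
  moreover have "inner_dual_adj E rot fo (orb (v, u1)) (orb (v, u2))"
    using adj_rot[OF u1 inner[OF u1]] inner[OF u2] by (simp flip: u2_def)
  moreover have "inner_dual_adj E rot fo (orb (v, u2)) (orb (v, u))"
    using adj_rot[OF u2 inner[OF u2]] inner[OF u] by (simp add: cyc)
  ultimately show False by (rule no_triangle)
qed

section \<open>Shared edges and the ordering of the inner faces\<close>

text \<open>These are the edges with an inner face on either side. The complement form is the one
  that Euler's formula can count.\<close>

definition S :: "'v set set" where "S = E - face_edges fo"

text \<open>The outer face passes every vertex exactly once and so has |V| edges; Euler's formula
  turns |E| - |V| into |IF| - 1, the size of a spanning tree on the inner faces.\<close>

lemma card_S: "card S + 1 = card IF"
proof -
  have "fst ` fo = V"
  proof
    show "fst ` fo \<subseteq> V" using face_D[OF fo_FS] edgeD dart_iff by fastforce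
    show "V \<subseteq> fst ` fo" using on_outer by (auto simp: face_vertices_def)
  qed
  moreover have "inj_on fst fo" using face_out_unique[OF fo_FS] by (auto simp: inj_on_def)
  ultimately have "card fo = card V" using card_image[of fst fo] by simp
  moreover have "face_edges fo = (\<lambda>d. {fst d, snd d}) ` fo"
    unfolding face_edges_def by force
  moreover have "inj_on (\<lambda>d. {fst d, snd d}) fo"
    using face_no_rev[OF fo_FS] by (force simp: inj_on_def doubleton_eq_iff)
  ultimately have "card (face_edges fo) = card V"
    using card_image[of "\<lambda>d. {fst d, snd d}" fo] by simp
  moreover have "face_edges fo \<subseteq> E" using face_edges_sub fo_FS by blast
  ultimately have "card S = card E - card V" "card V \<le> card E"
    using finite_E card_Diff_subset[of "face_edges fo" E] card_mono[of E "face_edges fo"]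
      finite_subset[of "face_edges fo" E] by (auto simp: S_def)
  moreover have "card IF = card FS - 1" "card FS > 0"
    using fo_FS finite_FS card_gt_0_iff by (auto simp: inner_faces_def)
  ultimately show ?thesis using euler by linarith
qed

lemma S_dart:
  assumes "{u, v} \<in> S"
  shows "(u, v) \<in> D" "orb (u, v) \<in> IF" "orb (v, u) \<in> IF"
  using assms orb_self[of "(u, v)"] orb_self[of "(v, u)"] orb_face[of "(u, v)"] orb_face[of "(v, u)"]
    dart_sym[of u v]
  by (auto simp: S_def dart_iff IF_iff face_edges_iff)

lemma S_if_two_inner:
  assumes "F \<in> IF" "F' \<in> IF" "F \<noteq> F'" "e \<in> face_edges F" "e \<in> face_edges F'"
  shows "e \<in> S"
  using inc_two[of F e F' fo] assms fo_FS inc_E[of F e] by (auto simp: S_def inc_def IF_iff)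

text \<open>The outer face already uses two edges at v, and the degree bound leaves room for one
  more.\<close>

lemma S_unique:
  assumes "e \<in> S" "e' \<in> S" "v \<in> e" "v \<in> e'"
  shows "e = e'"
proof -
  have other: "\<exists>w. e = {v, w}" if "e \<in> S" "v \<in> e" for e
  proof -
    have "e \<in> E" using that by (simp add: S_def)
    then obtain a b where "e = {a, b}" using edgeE by metis
    then show ?thesis using that by auto
  qed
  obtain w w' where w: "e = {v, w}" "e' = {v, w'}" using other[of e] other[of e'] assms by blast
  have "v \<in> V" using w assms edgeD[of v w] by (simp add: S_def)
  then obtain a where a: "(v, a) \<in> fo" using on_outer[of v] unfolding face_vertices_iff_out by blast
  obtain b where b: "(b, v) \<in> fo" by (rule face_in_dart[OF fo_FS a])
  have "a \<noteq> b" using face_no_rev[OF fo_FS a] b by auto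
  have ww: "w \<notin> {a, b}" "w' \<notin> {a, b}"
    using a b w assms by (auto simp: S_def face_edges_iff)
  have D: "(v, w) \<in> D" "(v, w') \<in> D" "(v, a) \<in> D" "(v, b) \<in> D"
    using w assms a b face_D[OF fo_FS] dart_sym[of v b] by (auto simp: S_def dart_iff)
  show ?thesis
  proof (rule ccontr)
    assume "e \<noteq> e'"
    then have "length [a, b, w, w'] \<le> 3"
      using ww w D \<open>a \<noteq> b\<close> by (intro nbrs_le[OF \<open>v \<in> V\<close>]) (auto simp: nbr_iff)
    then show False by simp
  qed
qed

lemma face_at:
  assumes "F \<in> FS" "v \<in> face_vertices F"
  obtains a b where "(v, a) \<in> F" "(b, v) \<in> F" "a \<noteq> b"
    "\<And>e. e \<in> face_edges F \<Longrightarrow> v \<in> e \<Longrightarrow> e = {v, a} \<or> e = {b, v}"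
proof -
  obtain a where a: "(v, a) \<in> F" using assms(2) unfolding face_vertices_iff_out by blast
  obtain b where b: "(b, v) \<in> F" by (rule face_in_dart[OF assms(1) a])
  have "a \<noteq> b" using face_no_rev[OF assms(1) a] b by auto
  moreover have "e = {v, a} \<or> e = {b, v}" if e: "e \<in> face_edges F" "v \<in> e" for e
  proof -
    obtain u w where "e = {u, w}" "(u, w) \<in> F" by (rule face_edgesE[OF e(1)])
    then show ?thesis
      using e(2) face_out_unique[OF assms(1) a, of w] face_in_unique[OF assms(1) b, of u] by auto
  qed
  ultimately show ?thesis using that[OF a b] by blast
qed

text \<open>Two consecutive edges of F cannot both be shared, as shared edges are disjoint. The
  outer edge found here serves as a marker of F.\<close>

lemma outer_edge_exists:
  assumes "F \<in> IF" obtains x where "x \<in> face_edges F" "x \<in> face_edges fo"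
proof -
  have F: "F \<in> FS" using assms IF_FS by blast
  obtain v u where "(v, u) \<in> F" by (rule face_has_dart[OF F])
  then have "v \<in> face_vertices F" by (rule face_vertices_out)
  then obtain a b where ab: "(v, a) \<in> F" "(b, v) \<in> F" "a \<noteq> b" using face_at[OF F] by metis
  have fe: "{v, a} \<in> face_edges F" "{b, v} \<in> face_edges F" using ab by (auto simp: face_edges_iff)
  moreover have "{v, a} \<noteq> {b, v}" using ab by (auto simp: doubleton_eq_iff)
  ultimately have "\<not> ({v, a} \<in> S \<and> {b, v} \<in> S)" using S_unique[of "{v, a}" "{b, v}" v] by auto
  then show ?thesis using fe face_edges_sub[OF F] that by (auto simp: S_def)
qed

lemma outer_edge_unique:
  assumes "F \<in> IF" "F' \<in> IF" "x \<in> face_edges F" "x \<in> face_edges fo" "x \<in> face_edges F'"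
  shows "F' = F"
  using S_if_two_inner[of F F' x] assms by (auto simp: S_def)

text \<open>The outgoing darts of the two faces at v lead to consecutive neighbours, so one of these
  two edges has F on one side and F' on the other.\<close>

lemma vertex_shared:
  assumes "F \<in> FS" "F' \<in> FS" "F \<noteq> F'" "v \<in> face_vertices F" "v \<in> face_vertices F'"
  shows "\<exists>e. v \<in> e \<and> e \<in> face_edges F \<and> e \<in> face_edges F'"
proof -
  have *: "\<exists>e. v \<in> e \<and> e \<in> face_edges F \<and> e \<in> face_edges F'"
    if F: "F \<in> FS" "F' \<in> FS" "(v, a) \<in> F" "(v, rot v a) \<in> F'" for F F' a
  proof -
    have "F' = orb (a, v)" using face_eq_orb[OF F(2,4)] orb_rot[of v a] face_D[OF F(1,3)] by simp
    then have "{v, a} \<in> face_edges F'" using orb_self[of "(a, v)"] by (simp add: face_edges_iff)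
    then show ?thesis using F(3) by (intro exI[of _ "{v, a}"]) (simp add: face_edges_iff)
  qed
  obtain a b where ab: "(v, a) \<in> F" "(v, b) \<in> F'"
    using assms(4,5) unfolding face_vertices_iff_out by blast
  have "a \<noteq> b" using ab assms(3) face_unique[OF assms(1,2)] by auto
  then have "b = rot v a \<or> a = rot v b"
    using rot_next[OF face_D[OF assms(1) ab(1)] face_D[OF assms(2) ab(2)]] by blast
  then show ?thesis using *[OF assms(1,2) ab(1)] *[OF assms(2,1) ab(2)] ab by blast
qed

text \<open>A search order uses |IF| - 1 distinct shared edges, and by \<open>card_S\<close> there
  are no others. Hence a new face can meet an earlier one only in its attaching edge, and the dual
  is a tree even when edges are counted with multiplicity.\<close>

lemma inner_order:
  assumes "F \<in> IF"
  obtains fs g where "set fs = IF" "fs \<noteq> []" "fs ! 0 = F" "distinct fs"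
    "\<And>j. 0 < j \<Longrightarrow> j < length fs \<Longrightarrow> g j \<in> face_edges (fs ! j) \<and> (\<exists>i<j. g j \<in> face_edges (fs ! i))"
    "\<And>i j e. i < j \<Longrightarrow> j < length fs \<Longrightarrow> e \<in> face_edges (fs ! i) \<Longrightarrow> e \<in> face_edges (fs ! j) \<Longrightarrow> e = g j"
    "\<And>i j v. i < j \<Longrightarrow> j < length fs \<Longrightarrow> v \<in> face_vertices (fs ! i) \<Longrightarrow> v \<in> face_vertices (fs ! j) \<Longrightarrow> v \<in> g j"
proof -
  have fin: "finite IF" using finite_FS by (simp add: inner_faces_def)
  have lnk: "linked IF (\<lambda>a b. \<exists>e\<in>E. inc a e \<and> inc b e)"
    unfolding linked_def
  proof (intro allI impI)
    fix C assume "C \<subseteq> IF" "C \<noteq> {}" "C \<noteq> IF"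
    then obtain a b where ab: "a \<in> C" "b \<in> IF - C" "inner_dual_adj E rot fo a b"
      using inner_linked[unfolded linked_def, rule_format, of C] by blast
    have "face_edges a \<inter> face_edges b \<noteq> {}" "a \<in> FS" "b \<in> FS"
      using ab(3) by (simp_all add: inner_dual_adj_def IF_iff)
    then obtain e where "e \<in> face_edges a" "e \<in> face_edges b" "a \<in> FS" "b \<in> FS" by blast
    then have inc: "inc a e" "inc b e" by (simp_all add: inc_def)
    have "e \<in> E" using inc_E[OF inc(1)] .
    then show "\<exists>a\<in>C. \<exists>b\<in>IF - C. \<exists>e\<in>E. inc a e \<and> inc b e" using ab inc by blast
  qed
  obtain fs g where fs: "set fs = IF" "fs \<noteq> []" "hd fs = F" "attach_order inc fs g"
    "g ` {1..<length fs} \<subseteq> E"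
    by (rule attach_order_exists[OF fin lnk assms])
  have dist: "distinct fs" using attach_orderD(1)[OF fs(4)] .
  have mem: "fs ! j \<in> IF" if "j < length fs" for j using fs(1) that nth_mem by blast
  have par: "g j \<in> face_edges (fs ! j) \<and> (\<exists>i<j. g j \<in> face_edges (fs ! i))"
    if "0 < j" "j < length fs" for j
    using attach_orderD(2,3)[OF fs(4) that] by (auto simp: inc_def)
  have neq: "fs ! i \<noteq> fs ! j" if "i < j" "j < length fs" for i j
    using dist that by (simp add: nth_eq_iff_index_eq)
  have gS: "g j \<in> S" if j: "0 < j" "j < length fs" for j
  proof -
    obtain i where i: "i < j" "g j \<in> face_edges (fs ! i)" "g j \<in> face_edges (fs ! j)"
      using par[OF j] by blast
    then show ?thesis
      using S_if_two_inner[OF mem[of i] mem[of j] neq[of i j]] j by simp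
  qed
  have "finite S" using finite_E by (simp add: S_def)
  moreover have "g ` {1..<length fs} \<subseteq> S" using gS by auto
  moreover have "card (g ` {1..<length fs}) = card S"
    using card_image[OF attach_order_inj[OF fs(4) inc_two]] card_S fs(1) distinct_card[OF dist]
    by simp
  ultimately have Seq: "g ` {1..<length fs} = S" by (rule card_subset_eq)
  have uniq: "e = g j"
    if ij: "i < j" "j < length fs" "e \<in> face_edges (fs ! i)" "e \<in> face_edges (fs ! j)" for i j e
  proof -
    have "e \<in> S" using S_if_two_inner[OF mem[of i] mem[of j] neq[of i j]] ij by simp
    then obtain l where l: "l \<in> {1..<length fs}" "e = g l" using Seq by blast
    have inc: "inc (fs ! i) e" "inc (fs ! j) e" "inc (fs ! l) e"
      using ij l par[of l] mem[of i] mem[of j] mem[of l] by (auto simp: inc_def IF_iff)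
    have "inc (fs ! j) (g l)" using inc(2) l(2) by simp
    then have "j \<le> l"
      using attach_order_last[where j = l and l = j, OF fs(4) inc_two] l(1) ij(2) by simp
    moreover have "\<not> j < l"
    proof
      assume "j < l"
      then have "fs ! i \<noteq> fs ! j" "fs ! i \<noteq> fs ! l" "fs ! j \<noteq> fs ! l"
        using neq[of i j] neq[of i l] neq[of j l] ij l by simp_all
      then show False using inc_two[OF inc] by simp
    qed
    ultimately show ?thesis using l by simp
  qed
  have vert: "v \<in> g j"
    if ij: "i < j" "j < length fs" "v \<in> face_vertices (fs ! i)" "v \<in> face_vertices (fs ! j)" for i j v
  proof -
    have "fs ! i \<in> FS" "fs ! j \<in> FS" using mem[of i] mem[of j] ij by (auto simp: IF_iff)
    then obtain e where "v \<in> e" "e \<in> face_edges (fs ! i)" "e \<in> face_edges (fs ! j)"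
      using vertex_shared[of "fs ! i" "fs ! j" v] neq[OF ij(1,2)] ij by blast
    then show ?thesis using uniq[of i j e] ij by simp
  qed
  show ?thesis
    by (rule that[of fs g]) (use fs dist par uniq vert in \<open>auto simp: hd_conv_nth\<close>)
qed

section \<open>Alternating classes of face edges\<close>

definition side :: "'v set" where "side = (SOME A. \<forall>e\<in>E. card (e \<inter> A) = 1)"

lemma side: assumes "{a, b} \<in> E" shows "a \<in> side \<longleftrightarrow> b \<notin> side"
proof -
  have "\<exists>A. \<forall>e\<in>E. card (e \<inter> A) = 1"
    using ers by (simp add: even_ring_system_def bipartite_def)
  then have "\<forall>e\<in>E. card (e \<inter> side) = 1" unfolding side_def by (rule someI_ex)
  then have "card ({a, b} \<inter> side) = 1" using assms by blast
  then show ?thesis using edgeD[OF assms] by (auto simp: Int_insert_left split: if_splits)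
qed

text \<open>Tails of darts alternate in colour along a face, so this is every other edge of its
  boundary. The class depends on the orientation given by the face: a shared edge is traversed in
  opposite directions by its two faces.\<close>

definition cls :: "('v \<times> 'v) set \<Rightarrow> bool \<Rightarrow> 'v set set" where
  "cls F c = {{a, b} | a b. (a, b) \<in> F \<and> (a \<in> side \<longleftrightarrow> c)}"

lemma cls_iff:
  assumes "F \<in> FS" "(a, b) \<in> F" shows "{a, b} \<in> cls F c \<longleftrightarrow> (a \<in> side \<longleftrightarrow> c)"
proof
  assume "{a, b} \<in> cls F c"
  then obtain x y where xy: "{a, b} = {x, y}" "(x, y) \<in> F" "x \<in> side \<longleftrightarrow> c"
    unfolding cls_def by blast
  then have "x = a" using face_no_rev[OF assms] by (auto simp: doubleton_eq_iff)
  then show "a \<in> side \<longleftrightarrow> c" using xy by simp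
next
  assume "a \<in> side \<longleftrightarrow> c"
  then show "{a, b} \<in> cls F c" using assms unfolding cls_def by blast
qed

lemma cls_compl:
  assumes "F \<in> FS" "e \<in> face_edges F" shows "e \<in> cls F (\<not> c) \<longleftrightarrow> e \<notin> cls F c"
proof -
  obtain a b where "e = {a, b}" "(a, b) \<in> F" by (rule face_edgesE[OF assms(2)])
  then show ?thesis using cls_iff[OF assms(1), of a b] by auto
qed

lemma cls_sub: "cls F c \<subseteq> face_edges F"
  unfolding cls_def face_edges_def by blast

lemma cls_Un: "face_edges F = cls F True \<union> cls F False"
  unfolding cls_def face_edges_def by blast

text \<open>One of the two darts of F at v starts at v, the other at a neighbour of the opposite
  colour, so each class takes one of them. Each class is thus a perfect matching of the boundary
  cycle.\<close>

lemma cls_ex1: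
  assumes "F \<in> FS" "v \<in> face_vertices F" shows "\<exists>!e. e \<in> cls F c \<and> v \<in> e"
proof -
  obtain a b where ab: "(v, a) \<in> F" "(b, v) \<in> F"
    and only: "\<And>e. e \<in> face_edges F \<Longrightarrow> v \<in> e \<Longrightarrow> e = {v, a} \<or> e = {b, v}"
    by (rule face_at[OF assms]) blast
  have "{b, v} \<in> E" using face_D[OF assms(1) ab(2)] by (simp add: dart_iff)
  then have side: "b \<in> side \<longleftrightarrow> v \<notin> side" by (rule side)
  have va: "{v, a} \<in> cls F c \<longleftrightarrow> (v \<in> side \<longleftrightarrow> c)" and bv: "{b, v} \<in> cls F c \<longleftrightarrow> (b \<in> side \<longleftrightarrow> c)"
    using cls_iff assms(1) ab by blast+
  have only': "e = {v, a} \<or> e = {b, v}" if "e \<in> cls F c" "v \<in> e" for e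
    using only that cls_sub by blast
  show ?thesis
  proof (cases "v \<in> side \<longleftrightarrow> c")
    case True
    then show ?thesis using va bv side only' by (intro ex1I[of _ "{v, a}"]) auto
  next
    case False
    then show ?thesis using va bv side only' by (intro ex1I[of _ "{b, v}"]) auto
  qed
qed

lemma cls_unique:
  assumes "F \<in> FS" "e \<in> cls F c" "e' \<in> cls F c" "v \<in> e" "v \<in> e'" shows "e = e'"
proof -
  have "v \<in> face_vertices F" using face_edges_vertices[OF assms(1)] assms(2,4) cls_sub by blast
  then show ?thesis using cls_ex1[OF assms(1), of v c] assms by blast
qed

lemma edge_in_inner:
  assumes "e \<in> E" obtains F where "F \<in> IF" "e \<in> face_edges F"
proof -
  obtain u v where e: "e = {u, v}" using edgeE[OF assms] by metis
  then have D: "(u, v) \<in> D" "(v, u) \<in> D" using assms dart_sym[of u v] by (simp_all add: dart_iff)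
  have fe: "e \<in> face_edges (orb (u, v))" "e \<in> face_edges (orb (v, u))"
    using orb_self[of "(u, v)"] orb_self[of "(v, u)"] by (simp_all add: e face_edges_iff)
  have "orb (u, v) \<noteq> fo \<or> orb (v, u) \<noteq> fo" using no_loop[OF D(1)] by auto
  then show ?thesis using that[OF _ fe(1)] that[OF _ fe(2)] orb_face[OF D(1)] orb_face[OF D(2)]
    by (auto simp: IF_iff)
qed

lemma vertex_in_inner:
  assumes "v \<in> V" obtains F where "F \<in> IF" "v \<in> face_vertices F"
proof -
  obtain a where "(v, a) \<in> fo" using on_outer[OF assms] unfolding face_vertices_iff_out by blast
  then have "{v, a} \<in> E" using face_D[OF fo_FS, of "(v, a)"] by (simp add: dart_iff)
  then obtain F where "F \<in> IF" "{v, a} \<in> face_edges F" by (rule edge_in_inner)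
  then show ?thesis using that face_edges_vertices[of F "{v, a}" v] IF_FS[of F] by simp
qed

section \<open>Faces as cycles and distances between their edges\<close>

text \<open>The least period of \<open>step\<close> at d enumerates the face without repetition and
  is therefore its number of darts.\<close>

lemma face_cycle:
  assumes "F \<in> FS" "d \<in> F"
  shows "bij_betw (\<lambda>i. (step ^^ i) d) {..<card F} F" "(step ^^ card F) d = d"
proof -
  have d: "d \<in> D" using face_D assms by blast
  define p where "p = (LEAST p. p > 0 \<and> (step ^^ p) d = d)"
  have p: "p > 0 \<and> (step ^^ p) d = d" unfolding p_def by (rule LeastI_ex) (rule period_exists[OF d])
  have least: "\<not> (0 < k \<and> (step ^^ k) d = d)" if "k < p" for k
    using that not_less_Least unfolding p_def by blast
  have neq: "(step ^^ i) d \<noteq> (step ^^ j) d" if ij: "i < j" "j < p" for i j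
  proof
    assume "(step ^^ i) d = (step ^^ j) d"
    also have "(step ^^ j) d = (step ^^ i) ((step ^^ (j - i)) d)"
      using ij by (simp flip: funpow_add comp_apply[of "step ^^ i"])
    finally have "d = (step ^^ (j - i)) d"
      using funpow_step_inj[OF d funpow_dart[OF d]] by blast
    then have "(step ^^ (j - i)) d = d" by (rule sym)
    moreover have "0 < j - i" "j - i < p" using ij by simp_all
    ultimately show False using least by blast
  qed
  have inj: "inj_on (\<lambda>i. (step ^^ i) d) {..<p}"
  proof (rule inj_onI)
    fix i j assume "i \<in> {..<p}" "j \<in> {..<p}" "(step ^^ i) d = (step ^^ j) d"
    then show "i = j" using neq[of i j] neq[of j i] by (cases i j rule: linorder_cases) auto
  qed
  have "F = orb d" using face_eq_orb assms by blast
  moreover have "orb d = (\<lambda>i. (step ^^ i) d) ` {..<p}"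
  proof
    show "orb d \<subseteq> (\<lambda>i. (step ^^ i) d) ` {..<p}"
    proof
      fix x assume "x \<in> orb d"
      then obtain k where "x = (step ^^ k) d" unfolding face_orbit_def by blast
      then have "x = (step ^^ (k mod p)) d" using p funpow_mod_eq[of p step d k] by simp
      then show "x \<in> (\<lambda>i. (step ^^ i) d) ` {..<p}" using p by auto
    qed
    show "(\<lambda>i. (step ^^ i) d) ` {..<p} \<subseteq> orb d" using orb_funpow by blast
  qed
  ultimately have F: "F = (\<lambda>i. (step ^^ i) d) ` {..<p}" by simp
  then have "card F = p" using card_image[OF inj] by simp
  then show "bij_betw (\<lambda>i. (step ^^ i) d) {..<card F} F" "(step ^^ card F) d = d"
    using inj F p by (auto simp: bij_betw_def)
qed

lemma fst_step: "fst (step d) = snd d" by (simp add: face_step_def)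

lemma side_funpow:
  assumes "d \<in> D" shows "fst ((step ^^ i) d) \<in> side \<longleftrightarrow> (fst d \<in> side \<longleftrightarrow> even i)"
proof (induction i)
  case (Suc i)
  define x where "x = (step ^^ i) d"
  have "{fst x, snd x} \<in> E" using funpow_dart[OF assms, of i] by (simp add: x_def flip: dart_iff)
  then have "fst x \<in> side \<longleftrightarrow> fst (step x) \<notin> side" using side by (simp add: fst_step)
  then show ?case using Suc by (auto simp: x_def)
qed simp

text \<open>The graph arises from F by gluing even cycles along single edges. Each new face folds
  onto its attaching edge, every vertex going to the end of its own colour; composing the folds
  gives a homomorphism to the boundary of F that fixes it.\<close>

lemma retraction_exists:
  assumes F: "F \<in> IF"
  obtains r where "\<And>v. v \<in> face_vertices F \<Longrightarrow> r v = v"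
    "\<And>a b. {a, b} \<in> E \<Longrightarrow> {r a, r b} \<in> face_edges F"
proof -
  obtain fs g where fs: "set fs = IF" "fs \<noteq> []" "fs ! 0 = F" "distinct fs"
    and par: "\<And>j. 0 < j \<Longrightarrow> j < length fs \<Longrightarrow>
      g j \<in> face_edges (fs ! j) \<and> (\<exists>i<j. g j \<in> face_edges (fs ! i))"
    and vert: "\<And>i j v. i < j \<Longrightarrow> j < length fs \<Longrightarrow> v \<in> face_vertices (fs ! i) \<Longrightarrow>
      v \<in> face_vertices (fs ! j) \<Longrightarrow> v \<in> g j"
    by (rule inner_order[OF F]) blast
  have mem: "fs ! j \<in> FS" if "j < length fs" for j using fs(1) that nth_mem IF_FS by blast
  define P where "P j r \<longleftrightarrow> (\<forall>v\<in>face_vertices F. r v = v) \<and>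
    (\<forall>i<j. \<forall>a b. {a, b} \<in> face_edges (fs ! i) \<longrightarrow> {r a, r b} \<in> face_edges F)" for j and r :: "'v \<Rightarrow> 'v"
  have "Suc n \<le> length fs \<Longrightarrow> \<exists>r. P (Suc n) r" for n
  proof (induction n)
    case 0
    have "P (Suc 0) (\<lambda>v. v)" using fs(3) by (simp add: P_def)
    then show ?case by blast
  next
    case (Suc n)
    define j where "j = Suc n"
    have j: "0 < j" "j < length fs" using Suc.prems by (simp_all add: j_def)
    obtain r where r: "P j r" using Suc j by (auto simp: j_def)
    obtain i0 where i0: "i0 < j" "g j \<in> face_edges (fs ! i0)" and gj: "g j \<in> face_edges (fs ! j)"
      using par[OF j] by blast
    have "g j \<in> E" using face_edges_sub[OF mem[OF j(2)]] gj by blast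
    then obtain p q where pq: "g j = {p, q}" "p \<in> side" "q \<notin> side"
    proof -
      obtain x y where xy: "g j = {x, y}" using edgeE[OF \<open>g j \<in> E\<close>] by metis
      then have "x \<in> side \<longleftrightarrow> y \<notin> side" using side \<open>g j \<in> E\<close> by simp
      then show ?thesis using that[of x y] that[of y x] xy by (auto simp: insert_commute)
    qed
    \<comment> \<open>New vertices follow the end of \<open>g j\<close> of their own colour. At
      \<open>p\<close> and \<open>q\<close> themselves this agrees with \<open>r\<close>.\<close>
    define r' where "r' v = (if \<exists>i<j. v \<in> face_vertices (fs ! i) then r v
      else if v \<in> side then r p else r q)" for v
    have new: "r' v = (if v \<in> side then r p else r q)" if v: "v \<in> face_vertices (fs ! j)" for v
    proof (cases "\<exists>i<j. v \<in> face_vertices (fs ! i)")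
      case True
      then obtain i where i: "i < j" "v \<in> face_vertices (fs ! i)" by blast
      then have "v \<in> {p, q}" using vert[OF i(1) j(2) i(2) v] pq(1) by simp
      then show ?thesis using True pq by (auto simp: r'_def)
    next
      case False
      then show ?thesis unfolding r'_def by (simp only: if_False)
    qed
    have "P (Suc j) r'"
      unfolding P_def
    proof (intro conjI ballI allI impI)
      fix v assume "v \<in> face_vertices F"
      moreover from this have "\<exists>i<j. v \<in> face_vertices (fs ! i)" using fs(3) j(1) by blast
      ultimately show "r' v = v" using r by (simp add: P_def r'_def)
    next
      fix i a b assume i: "i < Suc j" and ab: "{a, b} \<in> face_edges (fs ! i)"
      have il: "i < length fs" using i j by simp
      have abv: "a \<in> face_vertices (fs ! i)" "b \<in> face_vertices (fs ! i)"
        using face_edges_vertices[OF mem[OF il] ab] by simp_all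
      show "{r' a, r' b} \<in> face_edges F"
      proof (cases "i = j")
        case True
        have "{a, b} \<in> E" using face_edges_sub[OF mem[OF il]] ab by blast
        then have "a \<in> side \<longleftrightarrow> b \<notin> side" by (rule side)
        then have "{r' a, r' b} = {r p, r q}" using new[of a] new[of b] abv True by auto
        moreover have "{r p, r q} \<in> face_edges F" using r i0 pq(1) by (simp add: P_def)
        ultimately show ?thesis by simp
      next
        case False
        then have "i < j" using i by simp
        then have "r' a = r a" "r' b = r b" using abv by (auto simp: r'_def)
        then show ?thesis using r \<open>i < j\<close> ab by (simp add: P_def)
      qed
    qed
    then show ?case by (auto simp: j_def)
  qed
  from this[of "length fs - 1"] obtain r where r: "P (length fs) r" using fs(2) by (cases fs) auto
  have "{r a, r b} \<in> face_edges F" if ab: "{a, b} \<in> E" for a b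
  proof -
    obtain F' where "F' \<in> IF" "{a, b} \<in> face_edges F'" by (rule edge_in_inner[OF ab])
    then obtain i where "i < length fs" "{a, b} \<in> face_edges (fs ! i)"
      using fs(1) by (metis in_set_conv_nth)
    then show ?thesis using r by (simp add: P_def)
  qed
  then show ?thesis using that[of r] r by (simp add: P_def)
qed

text \<open>Here h is a potential changing by at most 1 along an edge. The sharper bound at one end
  comes from the vertex shared with the preceding edge of the walk; it makes the resulting estimate
  of the distance exact.\<close>

lemma line_walk_bound:
  fixes h :: "'v \<Rightarrow> nat"
  assumes lip: "\<And>a b. {a, b} \<in> E \<Longrightarrow> h b \<le> h a + 1"
    and e: "\<And>v. v \<in> e \<Longrightarrow> h v = 0"
    and walk: "(e, f) \<in> {(a, b). line_adj E a b} ^^ n"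
  shows "(\<forall>v\<in>f. h v \<le> n) \<and> (n > 0 \<longrightarrow> (\<exists>v\<in>f. h v < n))"
  using walk
proof (induction n arbitrary: f)
  case 0
  then show ?case using e by auto
next
  case (Suc n)
  then obtain x where x: "(e, x) \<in> {(a, b). line_adj E a b} ^^ n" "line_adj E x f" by auto
  then obtain w where w: "w \<in> x" "w \<in> f" "f \<in> E" by (auto simp: line_adj_def)
  have hw: "h w \<le> n" using Suc.IH[OF x(1)] w by blast
  have "h v \<le> Suc n" if v: "v \<in> f" for v
  proof (cases "v = w")
    case False
    then have "f = {w, v}" using edgeE[OF w(3)] w v by (metis insert_iff singletonD insert_commute)
    then show ?thesis using lip[of w v] w hw by simp
  qed (use hw in simp)
  then show ?case using w hw by (auto intro!: bexI[of _ w])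
qed

lemma relpow_sym:
  assumes "sym R" "(x, y) \<in> R ^^ n" shows "(y, x) \<in> R ^^ n"
  using assms(2)
proof (induction n arbitrary: y)
  case (Suc n)
  then obtain z where "(x, z) \<in> R ^^ n" "(z, y) \<in> R" by auto
  then show ?case using Suc.IH assms(1) by (meson relpow_Suc_I2 symD)
qed simp

text \<open>The retraction onto the face shows that leaving the face does not shorten a walk between two
  of its edges, so their distance is the one along the face cycle.\<close>
lemma edge_dist_even_iff:
  assumes F: "F \<in> IF" and e: "e \<in> face_edges F" and f: "f \<in> face_edges F" and ef: "e \<noteq> f"
  shows "even (edge_dist E e f) \<longleftrightarrow> (\<exists>c. e \<in> cls F c \<and> f \<in> cls F c)"
proof -
  have FF: "F \<in> FS" using F IF_FS by blast
  obtain a b where ab: "e = {a, b}" "(a, b) \<in> F" by (rule face_edgesE[OF e])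
  define d where "d i = (step ^^ i) (a, b)" for i
  define L where "L = card F"
  have bij: "bij_betw d {..<L} F" and dL: "d L = d 0"
    using face_cycle[OF FF ab(2)] unfolding d_def L_def by simp_all
  have dF: "d i \<in> F" for i using face_step_in[OF FF] ab(2) by (induction i) (simp_all add: d_def)
  have dart: "d i \<in> D" for i using face_D[OF FF dF] .
  define ed where "ed i = {fst (d i), snd (d i)}" for i
  have snd_d: "snd (d i) = fst (d (Suc i))" for i by (simp add: d_def fst_step)
  have edE: "ed i \<in> E" for i using dart[of i] unfolding ed_def by (simp flip: dart_iff)
  have ed_eq: "d i = d j" if "ed i = ed j" for i j
    using that face_no_rev[OF FF, of "fst (d i)" "snd (d i)"] dF[of i] dF[of j]
    unfolding ed_def doubleton_eq_iff by (cases "d i"; cases "d j") auto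
  have fst_eq: "i = j" if "fst (d i) = fst (d j)" "i < L" "j < L" for i j
  proof -
    have "d i = d j" using face_out_unique[OF FF, of "fst (d i)" "snd (d i)" "snd (d j)"] dF[of i] dF[of j] that(1)
      by (cases "d i"; cases "d j") auto
    then show ?thesis using bij that unfolding bij_betw_def inj_on_def by blast
  qed
  have e0: "e = ed 0" using ab by (simp add: ed_def d_def)
  obtain i where i: "i < L" "f = ed i"
  proof -
    obtain x y where xy: "f = {x, y}" "(x, y) \<in> F" by (rule face_edgesE[OF f])
    then obtain i where "i < L" "d i = (x, y)" using bij unfolding bij_betw_def by (metis imageE lessThan_iff)
    then show ?thesis using that xy by (simp add: ed_def)
  qed
  have i0: "0 < i" using ef e0 i by (cases i) auto
  have "fst (d L) \<in> side \<longleftrightarrow> (fst (d 0) \<in> side \<longleftrightarrow> even L)"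
    using side_funpow[OF dart[of 0], of L] by (simp add: d_def)
  then have evL: "even L" using dL by auto
  have adj: "line_adj E (ed j) (ed (Suc j))" for j
  proof -
    have "ed j \<noteq> ed (Suc j)"
    proof
      assume "ed j = ed (Suc j)"
      then have "d j = d (Suc j)" by (rule ed_eq)
      then have "fst (d j) = snd (d j)" using snd_d[of j] by simp
      then show False using edgeD[of "fst (d j)" "snd (d j)"] edE[of j] by (simp add: ed_def)
    qed
    moreover have "snd (d j) \<in> ed j \<inter> ed (Suc j)" using snd_d[of j] by (simp add: ed_def)
    ultimately show ?thesis using edE[of j] edE[of "Suc j"] by (auto simp: line_adj_def)
  qed
  have walk: "(ed j, ed (j + k)) \<in> {(a, b). line_adj E a b} ^^ k" for j k
  proof (induction k)
    case (Suc k)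
    then show ?case using adj[of "j + k"] by (auto intro: relpow_Suc_I)
  qed simp
  have up1: "(e, f) \<in> {(a, b). line_adj E a b} ^^ i" using walk[of 0 i] e0 i by simp
  have "sym {(a, b). line_adj E a b}" by (auto simp: sym_def line_adj_def)
  moreover have "(f, e) \<in> {(a, b). line_adj E a b} ^^ (L - i)"
  proof -
    have "ed L = ed 0" using dL by (simp add: ed_def)
    then show ?thesis using walk[of i "L - i"] e0 i by simp
  qed
  ultimately have up2: "(e, f) \<in> {(a, b). line_adj E a b} ^^ (L - i)" by (rule relpow_sym)
  obtain r where r: "\<And>v. v \<in> face_vertices F \<Longrightarrow> r v = v"
    "\<And>a b. {a, b} \<in> E \<Longrightarrow> {r a, r b} \<in> face_edges F"
    by (rule retraction_exists[OF F]) blast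
  define idx where "idx v = (THE i. i < L \<and> fst (d i) = v)" for v
  have idx: "idx (fst (d j)) = j" if "j < L" for j
    unfolding idx_def using that fst_eq by (intro the_equality) auto
  \<comment> \<open>The distance along the cycle from a vertex to e, whose ends have index 0 and 1.
    Truncated subtraction yields 0 at index 0, and the formula also yields 0 at j = L, where the
    cycle has closed up.\<close>
  define h where "h v = min (idx v - 1) (L - idx v)" for v
  have h_d: "h (fst (d j)) = min (j - 1) (L - j)" if "j \<le> L" for j
  proof (cases "j = L")
    case True
    then show ?thesis using idx[of 0] i dL by (simp add: h_def)
  next
    case False
    then show ?thesis using idx[of j] that by (simp add: h_def)
  qed
  have lip: "h (r y) \<le> h (r x) + 1" if xy: "{x, y} \<in> E" for x y
  proof -
    obtain u v where uv: "{r x, r y} = {u, v}" "(u, v) \<in> F" by (rule face_edgesE[OF r(2)[OF xy]])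
    then obtain j where j: "j < L" "d j = (u, v)" using bij unfolding bij_betw_def by (metis imageE lessThan_iff)
    then have "h u = min (j - 1) (L - j)" "h v = min j (L - Suc j)"
      using h_d[of j] h_d[of "Suc j"] snd_d[of j] by simp_all
    then have "h u \<le> h v + 1 \<and> h v \<le> h u + 1" using j(1) by linarith
    then show ?thesis using uv(1) by (auto simp: doubleton_eq_iff)
  qed
  have edr: "r v = v" if "v \<in> ed j" for v j
    using that dF[of j] face_edges_vertices[OF FF, of "ed j" v]
    by (intro r(1)) (auto simp: ed_def face_edges_iff)
  have zero: "h (r v) = 0" if "v \<in> e" for v
    using edr[of v 0] that e0 h_d[of 0] h_d[of 1] snd_d[of 0] i by (auto simp: ed_def)
  have low: "min i (L - i) \<le> n" if n: "(e, f) \<in> {(a, b). line_adj E a b} ^^ n" for n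
  proof -
    have "n \<noteq> 0" using n ef by (cases n) auto
    then obtain v where v: "v \<in> f" "h (r v) < n"
      using line_walk_bound[of "\<lambda>v. h (r v)", OF lip zero n] by blast
    have "h v < n" using v edr[of v i] i by simp
    moreover have "v = fst (d i) \<or> v = fst (d (Suc i))" using v i snd_d[of i] by (auto simp: ed_def)
    ultimately have "min (i - 1) (L - i) < n \<or> min i (L - Suc i) < n"
      using h_d[of i] h_d[of "Suc i"] i by auto
    then show ?thesis using i0 i(1) by linarith
  qed
  have "edge_dist E e f = min i (L - i)"
    unfolding edge_dist_def
  proof (rule Least_equality)
    show "(e, f) \<in> {(a, b). line_adj E a b} ^^ min i (L - i)" using up1 up2 by (simp add: min_def)
  qed (rule low)
  \<comment> \<open>Since L is even, i and L - i have the same parity, so it does not matter which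
    way round is shorter.\<close>
  then have "even (edge_dist E e f) \<longleftrightarrow> even i" using evL i by (simp add: min_def)
  moreover have "fst (d i) \<in> side \<longleftrightarrow> (fst (d 0) \<in> side \<longleftrightarrow> even i)"
    using side_funpow[OF dart[of 0], of i] by (simp add: d_def)
  moreover have "ed j \<in> cls F c \<longleftrightarrow> (fst (d j) \<in> side \<longleftrightarrow> c)" for j c
    unfolding ed_def using dF[of j] by (intro cls_iff[OF FF]) simp
  ultimately show ?thesis using e0 i(2) by auto
qed

section \<open>Perfect matchings alternating on a face\<close>

abbreviation "PM \<equiv> perfect_matchings V E"

lemma PM_iff: "M \<in> PM \<longleftrightarrow> M \<subseteq> E \<and> (\<forall>v\<in>V. \<exists>!e. e \<in> M \<and> v \<in> e)"
  by (simp add: perfect_matchings_def)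

lemma PM_unique:
  assumes "M \<in> PM" "e \<in> M" "e' \<in> M" "v \<in> e" "v \<in> e'" shows "e = e'"
proof -
  have "e \<in> E" using assms(1,2) PM_iff by blast
  then have "v \<in> V" using edgeE[of e] assms(4) by blast
  then show ?thesis using assms unfolding PM_iff by blast
qed

text \<open>Either class of F is completed by the same set X, which adds the later faces one after
  the other, so the two matchings differ exactly on F.\<close>

lemma alternating_PM_exists:
  assumes F: "F \<in> IF"
  obtains M M' where "M \<in> PM" "M' \<in> PM" "(M - M') \<union> (M' - M) = face_edges F"
proof -
  obtain fs g where fs: "set fs = IF" "fs \<noteq> []" "fs ! 0 = F" "distinct fs"
    and par: "\<And>j. 0 < j \<Longrightarrow> j < length fs \<Longrightarrow>
      g j \<in> face_edges (fs ! j) \<and> (\<exists>i<j. g j \<in> face_edges (fs ! i))"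
    and uniq: "\<And>i j e. i < j \<Longrightarrow> j < length fs \<Longrightarrow> e \<in> face_edges (fs ! i) \<Longrightarrow>
      e \<in> face_edges (fs ! j) \<Longrightarrow> e = g j"
    and vert: "\<And>i j v. i < j \<Longrightarrow> j < length fs \<Longrightarrow> v \<in> face_vertices (fs ! i) \<Longrightarrow>
      v \<in> face_vertices (fs ! j) \<Longrightarrow> v \<in> g j"
    by (rule inner_order[OF F]) blast
  have FF: "F \<in> FS" using F IF_FS by blast
  have mem: "fs ! j \<in> FS" if "j < length fs" for j using fs(1) that nth_mem IF_FS by blast
  define cc where "cc j \<longleftrightarrow> g j \<in> cls (fs ! j) True" for j
  have gcc: "g j \<in> cls (fs ! j) (cc j)" if "0 < j" "j < length fs" for j
  proof -
    have "g j \<in> cls (fs ! j) True \<or> g j \<in> cls (fs ! j) False"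
      using cls_Un[of "fs ! j"] par[OF that] by blast
    then show ?thesis by (cases "g j \<in> cls (fs ! j) True") (simp_all add: cc_def)
  qed
  \<comment> \<open>The ends of \<open>g j\<close> lie on earlier faces and are covered there; the
    rest of its class covers exactly the new vertices of the face.\<close>
  define R where "R j = cls (fs ! j) (cc j) - {g j}" for j
  define X where "X = (\<Union>j\<in>{1..<length fs}. R j)"
  have R_fe: "R j \<subseteq> face_edges (fs ! j)" for j using cls_sub unfolding R_def by blast
  have R_new: "v \<in> face_vertices (fs ! j)" "\<And>i. i < j \<Longrightarrow> v \<notin> face_vertices (fs ! i)"
    if j: "0 < j" "j < length fs" and e: "e \<in> R j" "v \<in> e" for j e v
  proof -
    show v: "v \<in> face_vertices (fs ! j)"
      using face_edges_vertices[OF mem[OF j(2)] _ e(2)] R_fe e(1) by blast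
    fix i assume i: "i < j"
    show "v \<notin> face_vertices (fs ! i)"
    proof
      assume "v \<in> face_vertices (fs ! i)"
      then have "v \<in> g j" using vert[OF i j(2)] v by blast
      then have "e = g j" using cls_unique[OF mem[OF j(2)] _ gcc[OF j] e(2)] e(1) by (simp add: R_def)
      then show False using e(1) by (simp add: R_def)
    qed
  qed
  have pm: "cls F c \<union> X \<in> PM" for c
    unfolding PM_iff
  proof (intro conjI ballI)
    have RE: "R j \<subseteq> E" if "j < length fs" for j using R_fe[of j] face_edges_sub[OF mem[OF that]] by blast
    have "X \<subseteq> E" unfolding X_def by (rule UN_least) (use RE in simp)
    moreover have "cls F c \<subseteq> E" using cls_sub[of F c] face_edges_sub[OF FF] by blast
    ultimately show "cls F c \<union> X \<subseteq> E" by blast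
    fix v assume "v \<in> V"
    then obtain F' where "F' \<in> IF" "v \<in> face_vertices F'" by (rule vertex_in_inner)
    then have ex: "\<exists>i. i < length fs \<and> v \<in> face_vertices (fs ! i)"
      using fs(1) by (metis in_set_conv_nth)
    \<comment> \<open>The first face containing v is the one responsible for covering it.\<close>
    define i where "i = (LEAST i. i < length fs \<and> v \<in> face_vertices (fs ! i))"
    have i: "i < length fs" "v \<in> face_vertices (fs ! i)"
      using LeastI_ex[OF ex] unfolding i_def by blast+
    have least: "v \<notin> face_vertices (fs ! k)" if "k < i" for k
      using not_less_Least[OF that[unfolded i_def]] that i(1) by simp
    have inX: "e \<in> R i \<and> 0 < i" if e: "e \<in> X" "v \<in> e" for e
    proof -
      obtain j where "j \<in> {1..<length fs}" and eR: "e \<in> R j" using e(1) unfolding X_def by blast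
      then have j: "0 < j" "j < length fs" "e \<in> R j" by simp_all
      have "j = i"
        using R_new[OF j e(2)] least[of j] i by (cases i j rule: linorder_cases) auto
      then show ?thesis using j by simp
    qed
    show "\<exists>!e. e \<in> cls F c \<union> X \<and> v \<in> e"
    proof (cases "i = 0")
      case True
      then have "\<exists>!e. e \<in> cls F c \<and> v \<in> e" using cls_ex1[OF FF] i fs(3) by simp
      moreover have "e \<notin> X" if "v \<in> e" for e using inX[of e] that True by blast
      ultimately show ?thesis by blast
    next
      case False
      then have i0: "0 < i" by simp
      have notF: "e \<notin> cls F c" if "v \<in> e" for e
      proof
        assume "e \<in> cls F c"
        then have "v \<in> face_vertices (fs ! 0)"
          using face_edges_vertices[OF FF _ that] cls_sub[of F c] fs(3) by blast
        then show False using least i0 by blast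
      qed
      obtain e where e: "e \<in> cls (fs ! i) (cc i)" "v \<in> e"
        and eu: "\<And>e'. e' \<in> cls (fs ! i) (cc i) \<Longrightarrow> v \<in> e' \<Longrightarrow> e' = e"
        using cls_ex1[OF mem[OF i(1)] i(2), of "cc i"] by blast
      obtain k where k: "k < i" "g i \<in> face_edges (fs ! k)" using par[OF i0 i(1)] by blast
      have "k < length fs" using k i by simp
      then have "v \<notin> g i" using face_edges_vertices[OF mem k(2), of v] least[OF k(1)] by blast
      then have "e \<in> R i" using e by (auto simp: R_def)
      then have "e \<in> X" using i0 i(1) unfolding X_def by auto
      moreover have "e' = e" if "e' \<in> X" "v \<in> e'" for e'
        using inX[OF that] eu that(2) by (simp add: R_def)
      ultimately show ?thesis using e(2) notF by blast
    qed
  qed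
  have disj: "e \<notin> X" if e: "e \<in> face_edges F" for e
  proof
    assume "e \<in> X"
    then obtain j where "j \<in> {1..<length fs}" and eR: "e \<in> R j" unfolding X_def by blast
    then have j: "0 < j" "j < length fs" "e \<in> R j" by simp_all
    then have "e = g j" using uniq[OF j(1,2), of e] e fs(3) R_fe[of j] by blast
    then show False using j(3) by (simp add: R_def)
  qed
  have "e \<notin> cls F False" if "e \<in> cls F True" for e
    using cls_compl[OF FF, of e True] that cls_sub[of F True] by auto
  then have "(cls F True \<union> X - (cls F False \<union> X)) \<union> (cls F False \<union> X - (cls F True \<union> X)) = face_edges F"
    using disj cls_Un[of F] by blast
  then show ?thesis using that[OF pm pm] by blast
qed

text \<open>If M had no edge of F at v, both edges of F at v would lie in the symmetric difference
  and hence in M'.\<close>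

lemma alternating_edge:
  assumes M: "M \<in> PM" "M' \<in> PM" and sd: "(M - M') \<union> (M' - M) = face_edges F" and F: "F \<in> FS"
    and v: "v \<in> face_vertices F"
  obtains m where "m \<in> M" "m \<in> face_edges F" "v \<in> m"
proof (rule ccontr)
  assume no: "\<not> thesis"
  obtain a b where ab: "(v, a) \<in> F" "(b, v) \<in> F" "a \<noteq> b" by (rule face_at[OF F v]) blast
  have fe: "{v, a} \<in> face_edges F" "{b, v} \<in> face_edges F" using ab by (auto simp: face_edges_iff)
  then have "{v, a} \<in> M'" "{b, v} \<in> M'" using no sd that by blast+
  then have "{v, a} = {b, v}" using PM_unique[OF M(2), of "{v, a}" "{b, v}" v] by simp
  then show False using ab(3) by (auto simp: doubleton_eq_iff)
qed

lemma alternating_cls: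
  assumes M: "M \<in> PM" "M' \<in> PM" and sd: "(M - M') \<union> (M' - M) = face_edges F" and F: "F \<in> FS"
  shows "\<exists>c. \<forall>e\<in>face_edges F. e \<in> M \<longleftrightarrow> e \<in> cls F c"
proof -
  \<comment> \<open>Both membership in M and the colour of the tail switch at every step, so their
    agreement is constant along the face; its value is the index of the class.\<close>
  define out where "out d \<longleftrightarrow> (({fst d, snd d} \<in> M) \<longleftrightarrow> (fst d \<in> side))" for d
  have stp: "out (step d) \<longleftrightarrow> out d" if d: "d \<in> F" for d
  proof -
    obtain u v where uv: "d = (u, v)" by (cases d)
    define w where "w = rot v u"
    have vw: "(v, w) \<in> F" using face_out_dart[OF F] d uv by (simp add: w_def)
    have fe: "{u, v} \<in> face_edges F" "{v, w} \<in> face_edges F"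
      using d uv vw by (auto simp: face_edges_iff)
    have "u \<in> side \<longleftrightarrow> v \<notin> side" using side[of u v] face_edges_sub[OF F] fe(1) by blast
    moreover have "{v, w} \<in> M \<longleftrightarrow> {u, v} \<notin> M"
    proof -
      have "v \<in> face_vertices F" by (rule face_vertices_out[OF vw])
      then obtain m where m: "m \<in> M" "m \<in> face_edges F" "v \<in> m"
        by (rule alternating_edge[OF M sd F])
      obtain a b where ab: "(v, a) \<in> F" "(b, v) \<in> F" "a \<noteq> b"
        and only: "\<And>e. e \<in> face_edges F \<Longrightarrow> v \<in> e \<Longrightarrow> e = {v, a} \<or> e = {b, v}"
        by (rule face_at[OF F \<open>v \<in> face_vertices F\<close>]) blast
      have "a = w" "b = u"
        using face_out_unique[OF F ab(1) vw] face_in_unique[OF F ab(2), of u] d uv by simp_all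
      then have "m = {v, w} \<or> m = {u, v}" using only[OF m(2,3)] by simp
      moreover have "{v, w} \<noteq> {u, v}" using ab(3) \<open>a = w\<close> \<open>b = u\<close> by (auto simp: doubleton_eq_iff)
      moreover have "{v, w} \<in> M \<Longrightarrow> {u, v} \<in> M \<Longrightarrow> {v, w} = {u, v}"
        using PM_unique[OF M(1), of "{v, w}" "{u, v}" v] by simp
      ultimately show ?thesis using m(1) by auto
    qed
    ultimately show ?thesis by (auto simp: out_def uv w_def)
  qed
  obtain x y where xy: "(x, y) \<in> F" by (rule face_has_dart[OF F])
  have "(step ^^ k) (x, y) \<in> F \<and> (out ((step ^^ k) (x, y)) \<longleftrightarrow> out (x, y))" for k
    using xy face_step_in[OF F] stp by (induction k) simp_all
  moreover have "F = orb (x, y)" using face_eq_orb[OF F xy] .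
  ultimately have const: "out d \<longleftrightarrow> out (x, y)" if "d \<in> F" for d
    using that unfolding face_orbit_def by blast
  have "e \<in> M \<longleftrightarrow> e \<in> cls F (out (x, y))" if e: "e \<in> face_edges F" for e
  proof -
    obtain u v where uv: "e = {u, v}" "(u, v) \<in> F" by (rule face_edgesE[OF e])
    have "out (u, v) \<longleftrightarrow> out (x, y)" using const uv(2) by blast
    then show ?thesis using cls_iff[OF F uv(2)] by (auto simp: out_def uv(1))
  qed
  then show ?thesis by blast
qed

text \<open>At an end v of a shared edge, both faces provide an edge of \<open>M0\<close> at v. The
  two coincide, so this edge is shared and by \<open>S_unique\<close> is the given one. Thus
  \<open>M0\<close> contains e and f, and alternation on F' puts them into one class.\<close>

lemma not_all_alternating:
  assumes M0: "M0 \<in> PM" and all: "\<And>F. F \<in> IF \<Longrightarrow> \<exists>M\<in>PM. (M0 - M) \<union> (M - M0) = face_edges F"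
    and F: "F \<in> IF" "F' \<in> IF" "F'' \<in> IF" "F \<noteq> F'" "F' \<noteq> F''"
    and e: "e \<in> face_edges F" "e \<in> face_edges F'" and f: "f \<in> face_edges F'" "f \<in> face_edges F''"
    and ef: "e \<noteq> f"
  shows "even (edge_dist E e f)"
proof -
  have inM: "x \<in> M0" if x: "x \<in> face_edges A" "x \<in> face_edges B" and AB: "A \<in> IF" "B \<in> IF" "A \<noteq> B"
    for A B x
  proof (rule ccontr)
    assume no: "x \<notin> M0"
    have xS: "x \<in> S" using S_if_two_inner[OF AB x] .
    have "x \<in> E" using xS by (simp add: S_def)
    then obtain v where v: "v \<in> x" using edgeE[of x] by blast
    have AF: "A \<in> FS" "B \<in> FS" using AB IF_FS by blast+
    obtain MA where MA: "MA \<in> PM" "(M0 - MA) \<union> (MA - M0) = face_edges A" using all[OF AB(1)] by blast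
    obtain MB where MB: "MB \<in> PM" "(M0 - MB) \<union> (MB - M0) = face_edges B" using all[OF AB(2)] by blast
    obtain m where m: "m \<in> M0" "m \<in> face_edges A" "v \<in> m"
      by (rule alternating_edge[OF M0 MA AF(1) face_edges_vertices[OF AF(1) x(1) v]])
    obtain m' where m': "m' \<in> M0" "m' \<in> face_edges B" "v \<in> m'"
      by (rule alternating_edge[OF M0 MB AF(2) face_edges_vertices[OF AF(2) x(2) v]])
    have "m' = m" using PM_unique[OF M0 m'(1) m(1) m'(3) m(3)] .
    then have "m \<in> S" using S_if_two_inner[OF AB, of m] m m' by simp
    then have "m = x" using S_unique[OF _ xS m(3) v] by blast
    then show False using m(1) no by simp
  qed
  have em: "e \<in> M0" and fm: "f \<in> M0" using inM e f F by blast+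
  obtain M where M: "M \<in> PM" "(M0 - M) \<union> (M - M0) = face_edges F'" using all[OF F(2)] by blast
  obtain c where "\<forall>x\<in>face_edges F'. x \<in> M0 \<longleftrightarrow> x \<in> cls F' c"
    using alternating_cls[OF M0 M IF_FS[OF F(2)]] by blast
  then have "e \<in> cls F' c" "f \<in> cls F' c" using em fm e f by blast+
  then show ?thesis using edge_dist_even_iff[OF F(2) e(2) f(1) ef] by blast
qed

section \<open>Daisy cube resonance graphs\<close>

text \<open>Opposite edges of a square in the resonance graph flip the same face: each face has an edge on
  the outer face, and this edge is flipped an even number of times around the square.\<close>
lemma square_faces:
  assumes F: "F1 \<in> IF" "F2 \<in> IF" "F3 \<in> IF" "F4 \<in> IF"
    and sd: "(A - B) \<union> (B - A) = face_edges F1" "(B - C) \<union> (C - B) = face_edges F2"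
      "(H - C) \<union> (C - H) = face_edges F3" "(A - H) \<union> (H - A) = face_edges F4"
    and ne: "A \<noteq> C" "B \<noteq> H"
  shows "F1 = F3"
proof (rule ccontr)
  assume neq: "F1 \<noteq> F3"
  obtain x where x: "x \<in> face_edges F1" "x \<in> face_edges fo" by (rule outer_edge_exists[OF F(1)])
  have only: "x \<notin> face_edges G" if "G \<in> IF" "G \<noteq> F1" for G
    using outer_edge_unique[OF F(1) that(1) x] that(2) by blast
  \<comment> \<open>Flipping the same face twice in a row would lead back to A.\<close>
  have "F2 \<noteq> F1"
  proof
    assume "F2 = F1"
    then have "(B - C) \<union> (C - B) = (A - B) \<union> (B - A)" using sd by simp
    then have "A = C" by blast
    then show False using ne by simp
  qed
  moreover have "F4 \<noteq> F1"
  proof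
    assume "F4 = F1"
    then have "(A - H) \<union> (H - A) = (A - B) \<union> (B - A)" using sd by simp
    then have "B = H" by blast
    then show False using ne by simp
  qed
  ultimately have no: "x \<notin> face_edges F2" "x \<notin> face_edges F3" "x \<notin> face_edges F4"
    using only F neq by blast+
  have "x \<in> B \<longleftrightarrow> x \<in> C" "x \<in> H \<longleftrightarrow> x \<in> C" "x \<in> A \<longleftrightarrow> x \<in> H"
    using no unfolding sd[symmetric] by blast+
  moreover have "x \<in> A \<longleftrightarrow> x \<notin> B" using x(1) unfolding sd(1)[symmetric] by blast
  ultimately show False by blast
qed

end

lemma hypercube_adj_cases:
  assumes "hypercube_adj u w"
  obtains i where "i < length u" "u ! i" "w = u[i := False]"
  | i where "i < length w" "w ! i" "u = w[i := False]"
proof -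
  have len: "length u = length w" using assms by (simp add: hypercube_adj_def)
  obtain i where i: "{i. i < length u \<and> u ! i \<noteq> w ! i} = {i}"
    using assms unfolding hypercube_adj_def by (meson card_1_singletonE)
  then have il: "i < length u" "u ! i \<noteq> w ! i" by blast+
  have same: "u ! j = w ! j" if "j < length u" "j \<noteq> i" for j using i that by blast
  show ?thesis
  proof (cases "u ! i")
    case True
    then have "w = u[i := False]"
      using il same len by (intro nth_equalityI) (auto simp: nth_list_update)
    then show ?thesis using that(1) il True by blast
  next
    case False
    then have "u = w[i := False]"
      using il same len by (intro nth_equalityI) (auto simp: nth_list_update)
    then show ?thesis using that(2)[of i] il False len by simp
  qed
qed

lemma hypercube_adj_update:
  assumes "i < length u" "u ! i" shows "hypercube_adj (u[i := False]) u"
proof -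
  have "{j. j < length u \<and> u[i := False] ! j \<noteq> u ! j} = {i}"
    using assms by (auto simp: nth_list_update)
  then show ?thesis by (simp add: hypercube_adj_def)
qed

lemma daisy_vertices_down:
  assumes "u \<in> daisy_vertices n X" "length w = n" "\<And>i. i < n \<Longrightarrow> w ! i \<Longrightarrow> u ! i"
  shows "w \<in> daisy_vertices n X"
proof -
  obtain x where x: "x \<in> X" "length u = n" "length u = length x" "\<forall>i<length u. u ! i \<longrightarrow> x ! i"
    using assms(1) unfolding daisy_vertices_def bvec_le_def by blast
  then have "bvec_le w x" using assms(2,3) by (simp add: bvec_le_def)
  then show ?thesis using x(1) assms(2) unfolding daisy_vertices_def by blast
qed

context cers
begin

text \<open>The matching at the bottom vertex of the daisy cube can be rotated along every face: the edge
  flipping a given face is moved down to the bottom through squares.\<close>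
lemma daisy_center:
  assumes "daisy_cube PM (resonance_adj V E rot fo)"
  obtains M0 where "M0 \<in> PM" "\<And>F. F \<in> IF \<Longrightarrow> \<exists>M\<in>PM. (M0 - M) \<union> (M - M0) = face_edges F"
proof -
  obtain n X f where X: "X \<subseteq> {x. length x = n}" and f: "bij_betw f PM (daisy_vertices n X)"
    and adj: "\<And>A B. A \<in> PM \<Longrightarrow> B \<in> PM \<Longrightarrow> resonance_adj V E rot fo A B \<longleftrightarrow> hypercube_adj (f A) (f B)"
    using assms unfolding daisy_cube_def by blast
  define g where "g = inv_into PM f"
  let ?DV = "daisy_vertices n X"
  have g: "g u \<in> PM" "f (g u) = u" if "u \<in> ?DV" for u
    using bij_betw_inv_into_right[OF f that] bij_betw_inv_into[OF f] that
    by (auto simp: g_def bij_betw_def)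
  have gf: "g (f M) = M" "f M \<in> ?DV" if "M \<in> PM" for M
    using bij_betw_inv_into_left[OF f that] f that by (auto simp: g_def bij_betw_def)
  have len: "length u = n" if "u \<in> ?DV" for u using that by (simp add: daisy_vertices_def)
  have lower: "u[i := False] \<in> ?DV" if "u \<in> ?DV" for u i
  proof (rule daisy_vertices_down[OF that])
    fix j assume "j < n" "u[i := False] ! j"
    then show "u ! j" using len[OF that] by (cases "j = i") simp_all
  qed (use len[OF that] in simp)
  have lab: "\<exists>F\<in>IF. (g (u[i := False]) - g u) \<union> (g u - g (u[i := False])) = face_edges F"
    if u: "u \<in> ?DV" "i < n" "u ! i" for u i
  proof -
    have "hypercube_adj (u[i := False]) u" using hypercube_adj_update[of i u] u len[OF u(1)] by simp
    then have "resonance_adj V E rot fo (g (u[i := False])) (g u)"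
      using adj[OF g(1)[OF lower[OF u(1)]] g(1)[OF u(1)]] g(2)[OF lower[OF u(1)]] g(2)[OF u(1)]
      by simp
    then show ?thesis by (simp add: resonance_adj_def)
  qed
  define z where "z = replicate n False"
  \<comment> \<open>Induction on the number of ones in u: the others are reset one by one, and the
    face flipped in direction i stays the same until i is the only one left.\<close>
  have move: "\<exists>M\<in>PM. (g z - M) \<union> (M - g z) = face_edges F"
    if "u \<in> ?DV" "i < n" "u ! i" "F \<in> IF"
      "(g (u[i := False]) - g u) \<union> (g u - g (u[i := False])) = face_edges F" for u i F
    using that
  proof (induction "card {l. l < n \<and> u ! l}" arbitrary: u rule: less_induct)
    case less
    have lu: "length u = n" using len less.prems(1) .
    show ?case
    proof (cases "\<exists>l<n. l \<noteq> i \<and> u ! l")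
      case False
      have "u[i := False] = z"
      proof (rule nth_equalityI)
        fix j assume "j < length (u[i := False])"
        then show "u[i := False] ! j = z ! j" using False lu by (cases "j = i") (auto simp: z_def)
      qed (simp add: z_def lu)
      then show ?thesis using less.prems(5) g(1)[OF less.prems(1)] by auto
    next
      case True
      then obtain l where l: "l < n" "l \<noteq> i" "u ! l" by blast
      define u' where "u' = u[l := False]"
      have u': "u' \<in> ?DV" "u' ! i" using lower[OF less.prems(1)] less.prems(3) l by (simp_all add: u'_def)
      have swap: "u'[i := False] = (u[i := False])[l := False]"
        using l(2) by (simp add: u'_def list_update_swap)
      have uil: "u[i := False] \<in> ?DV" "u[i := False] ! l"
        using lower[OF less.prems(1)] l by simp_all
      obtain F1 where F1: "F1 \<in> IF"
        "(g (u'[i := False]) - g u') \<union> (g u' - g (u'[i := False])) = face_edges F1"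
        using lab[OF u'(1) less.prems(2) u'(2)] by blast
      obtain F2 where F2: "F2 \<in> IF" "(g u' - g u) \<union> (g u - g u') = face_edges F2"
        using lab[OF less.prems(1) l(1,3)] unfolding u'_def by blast
      obtain F4 where F4: "F4 \<in> IF"
        "(g (u'[i := False]) - g (u[i := False])) \<union> (g (u[i := False]) - g (u'[i := False])) = face_edges F4"
        using lab[OF uil(1) l(1) uil(2)] unfolding swap by blast
      have "u'[i := False] \<noteq> u" using less.prems(2,3) lu by (metis length_list_update nth_list_update_eq u'_def)
      then have ne1: "g (u'[i := False]) \<noteq> g u"
        using g(2)[OF lower[OF u'(1)]] g(2)[OF less.prems(1)] by metis
      have "u' \<noteq> u[i := False]" using u'(2) less.prems(2) lu by (metis nth_list_update_eq)
      then have ne2: "g u' \<noteq> g (u[i := False])"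
        using g(2)[OF u'(1)] g(2)[OF uil(1)] by metis
      \<comment> \<open>The square consists of u and the vertices with i, l or both reset; its two
        edges in direction i are opposite.\<close>
      have eq: "F1 = F"
        by (rule square_faces[OF F1(1) F2(1) less.prems(4) F4(1) F1(2) F2(2) less.prems(5) F4(2) ne1 ne2])
      have "{k. k < n \<and> u' ! k} \<subset> {k. k < n \<and> u ! k}"
        using l lu by (auto simp: u'_def nth_list_update split: if_splits)
      then have "card {k. k < n \<and> u' ! k} < card {k. k < n \<and> u ! k}"
        by (intro psubset_card_mono) auto
      then show ?thesis
        by (rule less.hyps) (use u' less.prems F1 eq in auto)
    qed
  qed
  have all: "\<exists>M\<in>PM. (g z - M) \<union> (M - g z) = face_edges F" if F: "F \<in> IF" for F
  proof -
    obtain M M' where M: "M \<in> PM" "M' \<in> PM" "(M - M') \<union> (M' - M) = face_edges F"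
      by (rule alternating_PM_exists[OF F])
    then have "resonance_adj V E rot fo M M'" using F by (auto simp: resonance_adj_def)
    then have "hypercube_adj (f M) (f M')" using adj M by blast
    then show ?thesis
    proof (cases rule: hypercube_adj_cases)
      case (1 i)
      then show ?thesis
        using move[of "f M" i F] gf[OF M(1)] gf[OF M(2)] len[of "f M"] M(3) F by (simp add: Un_commute)
    next
      case (2 i)
      then show ?thesis
        using move[of "f M'" i F] gf[OF M(1)] gf[OF M(2)] len[of "f M'"] M(3) F by simp
    qed
  qed
  \<comment> \<open>Some perfect matching is needed to see that the cube is nonempty and hence
    contains its bottom \<open>z\<close>.\<close>
  obtain F where "F \<in> IF" using cers unfolding CERS_def is_tree_def by blast
  then obtain M where "M \<in> PM" by (rule alternating_PM_exists)
  then have "z \<in> ?DV" by (intro daisy_vertices_down[OF gf(2)]) (simp_all add: z_def)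
  then show ?thesis using that[of "g z"] g(1) all by blast
qed

lemma regular_if_daisy:
  assumes "daisy_cube PM (resonance_adj V E rot fo)"
  shows "regular_CERS V E rot fo"
proof -
  obtain M0 where M0: "M0 \<in> PM"
    and all: "\<And>F. F \<in> IF \<Longrightarrow> \<exists>M\<in>PM. (M0 - M) \<union> (M - M0) = face_edges F"
    by (rule daisy_center[OF assms]) blast
  have "even (edge_dist E e f)"
    if F: "F \<in> IF" "F' \<in> IF" "F'' \<in> IF" "F \<noteq> F'" "F' \<noteq> F''" "F \<noteq> F''"
      and e: "e \<in> face_edges F" "e \<in> face_edges F'" and f: "f \<in> face_edges F'" "f \<in> face_edges F''"
    for F F' F'' e f
  proof (rule not_all_alternating[OF M0 all F(1-5) e f])
    show "e \<noteq> f"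
      using inc_two[of F e F' F''] F e f IF_FS by (auto simp: inc_def)
  qed auto
  then show ?thesis unfolding regular_CERS_def by blast
qed

section \<open>Regular systems\<close>

lemma S_other:
  assumes "e \<in> S" "F \<in> IF" "e \<in> face_edges F"
  obtains F' where "F' \<in> IF" "F' \<noteq> F" "e \<in> face_edges F'"
proof -
  have "e \<in> E" using assms(1) by (simp add: S_def)
  then obtain u v where e: "e = {u, v}" using edgeE[of e] by metis
  have s: "(u, v) \<in> D" "orb (u, v) \<in> IF" "orb (v, u) \<in> IF" using S_dart assms(1) e by blast+
  have fe: "e \<in> face_edges (orb (u, v))" "e \<in> face_edges (orb (v, u))"
    using orb_self[of "(u, v)"] orb_self[of "(v, u)"] by (simp_all add: e face_edges_iff)
  show ?thesis using that[OF s(2) _ fe(1)] that[OF s(3) _ fe(2)] no_loop[OF s(1)] by metis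
qed

text \<open>Two shared edges of F lead to neighbours F1 and F2, and the triple F1, F, F2 is regular.
  Being in a common class pairwise suffices, because the two classes are complementary.\<close>

lemma regular_shared_cls:
  assumes reg: "regular_CERS V E rot fo" and F: "F \<in> IF"
  shows "\<exists>c. \<forall>e\<in>face_edges F \<inter> S. e \<in> cls F c"
proof -
  have FF: "F \<in> FS" using F IF_FS by blast
  have pair: "\<exists>c. e \<in> cls F c \<and> f \<in> cls F c"
    if e: "e \<in> face_edges F" "e \<in> S" and f: "f \<in> face_edges F" "f \<in> S" for e f
  proof (cases "e = f")
    case True
    then show ?thesis using cls_Un[of F] e(1) by blast
  next
    case False
    obtain F1 where F1: "F1 \<in> IF" "F1 \<noteq> F" "e \<in> face_edges F1" by (rule S_other[OF e(2) F e(1)])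
    obtain F2 where F2: "F2 \<in> IF" "F2 \<noteq> F" "f \<in> face_edges F2" by (rule S_other[OF f(2) F f(1)])
    \<comment> \<open>Otherwise F and F1 would share both e and f.\<close>
    have "F1 \<noteq> F2"
    proof
      assume eq: "F1 = F2"
      obtain fs g where fs: "set fs = IF" "fs ! 0 = F"
        and uniq: "\<And>i j e. i < j \<Longrightarrow> j < length fs \<Longrightarrow> e \<in> face_edges (fs ! i) \<Longrightarrow>
          e \<in> face_edges (fs ! j) \<Longrightarrow> e = g j"
        by (rule inner_order[OF F]) blast
      obtain j where j: "j < length fs" "fs ! j = F1" using F1(1) fs(1) by (metis in_set_conv_nth)
      then have "0 < j" using F1(2) fs(2) by (cases j) auto
      then have "e = g j" "f = g j"
        using uniq[of 0 j e] uniq[of 0 j f] j fs(2) e(1) f(1) F1(3) F2(3) eq by simp_all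
      then show False using False by simp
    qed
    moreover have "\<not> card IF \<le> 2"
    proof
      assume "card IF \<le> 2"
      moreover have "card {F1, F, F2} \<le> card IF"
        using F F1 F2 finite_FS by (intro card_mono) (auto simp: inner_faces_def)
      ultimately show False using F1(2) F2(2) \<open>F1 \<noteq> F2\<close> by (auto simp: card_insert_if)
    qed
    then have "\<forall>F F' F'' e f. F \<in> IF \<and> F' \<in> IF \<and> F'' \<in> IF \<and> F \<noteq> F' \<and> F' \<noteq> F'' \<and> F \<noteq> F'' \<and>
        e \<in> face_edges F \<inter> face_edges F' \<and> f \<in> face_edges F' \<inter> face_edges F''
        \<longrightarrow> even (edge_dist E e f)"
      using reg unfolding regular_CERS_def by blast
    from this[rule_format, of F1 F F2 e f] have "even (edge_dist E e f)"
      using F F1 F2 e f \<open>F1 \<noteq> F2\<close> by auto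
    then show ?thesis using edge_dist_even_iff[OF F e(1) f(1) False] by blast
  qed
  show ?thesis
  proof (cases "face_edges F \<inter> S = {}")
    case False
    then obtain e0 where e0: "e0 \<in> face_edges F" "e0 \<in> S" by blast
    obtain c where c: "e0 \<in> cls F c" using pair[OF e0 e0] by blast
    have "f \<in> cls F c" if f: "f \<in> face_edges F" "f \<in> S" for f
    proof -
      obtain c' where c': "e0 \<in> cls F c'" "f \<in> cls F c'" using pair[OF e0 f] by blast
      then have "c' = c" using cls_compl[OF FF e0(1), of c] c by (cases c; cases c') auto
      then show ?thesis using c' by simp
    qed
    then show ?thesis by blast
  qed auto
qed

text \<open>The vertices of W are partitioned by the matching edges: one with both ends in W
  contributes two of them, a cut edge one.\<close>

lemma PM_cut_parity:
  assumes M: "M \<in> PM"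
  shows "even (card (M \<inter> cut W)) \<longleftrightarrow> even (card (W \<inter> V))"
proof -
  have ME: "M \<subseteq> E" using M PM_iff by blast
  have finM: "finite M" using ME finite_E finite_subset by blast
  have "W \<inter> V = (\<Union>e\<in>M. e \<inter> W)"
  proof
    show "W \<inter> V \<subseteq> (\<Union>e\<in>M. e \<inter> W)"
    proof
      fix v assume v: "v \<in> W \<inter> V"
      then obtain e where "e \<in> M" "v \<in> e" using M unfolding PM_iff by blast
      then show "v \<in> (\<Union>e\<in>M. e \<inter> W)" using v by blast
    qed
    show "(\<Union>e\<in>M. e \<inter> W) \<subseteq> W \<inter> V"
    proof
      fix v assume "v \<in> (\<Union>e\<in>M. e \<inter> W)"
      then obtain e where e: "e \<in> M" "v \<in> e" "v \<in> W" by blast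
      then show "v \<in> W \<inter> V" using ME edgeE[of e] by blast
    qed
  qed
  moreover have "card (\<Union>e\<in>M. e \<inter> W) = (\<Sum>e\<in>M. card (e \<inter> W))"
  proof (rule card_UN_disjoint[OF finM])
    show "\<forall>e\<in>M. finite (e \<inter> W)"
    proof
      fix e assume "e \<in> M"
      then obtain u v where "e = {u, v}" using ME edgeE[of e] by blast
      then show "finite (e \<inter> W)" by simp
    qed
    show "\<forall>e\<in>M. \<forall>e'\<in>M. e \<noteq> e' \<longrightarrow> e \<inter> W \<inter> (e' \<inter> W) = {}"
      using PM_unique[OF M] by blast
  qed
  moreover have "M \<inter> cut W = {e \<in> M. odd (card (e \<inter> W))}"
  proof -
    have "e \<in> cut W \<longleftrightarrow> odd (card (e \<inter> W))" if e: "e \<in> M" for e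
    proof -
      have "e \<in> E" using e ME by blast
      obtain u v where uv: "e = {u, v}" "u \<noteq> v" using edgeE[OF \<open>e \<in> E\<close>] by metis
      have "e \<in> cut W \<longleftrightarrow> (u \<in> W \<longleftrightarrow> v \<notin> W)" using cut_iff[of u v W] uv \<open>e \<in> E\<close> by simp
      then show ?thesis using uv by (cases "u \<in> W"; cases "v \<in> W") simp_all
    qed
    then show ?thesis by blast
  qed
  ultimately show ?thesis using even_sum_iff[OF finM, of "\<lambda>e. card (e \<inter> W)"] by simp
qed

text \<open>Two outer edges of an inner face form a cut, which every perfect matching meets in the same
  parity.\<close>
lemma outer_edges_agree:
  assumes M: "M \<in> PM" "M' \<in> PM" and F: "F \<in> IF" and x: "x \<in> face_edges F" "x \<in> face_edges fo"
    and y: "y \<in> face_edges F" "y \<in> face_edges fo"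
  shows "(x \<in> M \<longleftrightarrow> x \<in> M') \<longleftrightarrow> (y \<in> M \<longleftrightarrow> y \<in> M')"
proof (cases "x = y")
  case False
  obtain W where W: "cut W = {x, y}" using two_cut[OF F x y False] by blast
  have par: "even (card (N \<inter> {x, y})) \<longleftrightarrow> (x \<in> N \<longleftrightarrow> y \<in> N)" for N
    using False by (cases "x \<in> N"; cases "y \<in> N") simp_all
  show ?thesis using PM_cut_parity[OF M(1), of W] PM_cut_parity[OF M(2), of W] par[of M] par[of M']
    unfolding W by blast
qed simp

section \<open>The edges at a vertex with and without a shared edge\<close>

lemma edge_at:
  assumes "e \<in> E" "v \<in> e" obtains x where "e = {v, x}" "(v, x) \<in> D"
proof -
  obtain a b where "e = {a, b}" using edgeE[OF assms(1)] by metis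
  then have "e = {v, a} \<or> e = {v, b}" using assms(2) by auto
  then show ?thesis using that assms(1) dart_iff by metis
qed

text \<open>The complete local picture: the shared edge lies between two outer edges, one for each
  of its faces, and the degree bound leaves no fourth edge. It reduces the covering of v to three
  edges.\<close>

lemma at_shared_vertex:
  assumes s: "s \<in> S" "v \<in> s"
  obtains F F' a a' where "F \<in> IF" "F' \<in> IF" "F \<noteq> F'" "s \<in> face_edges F" "s \<in> face_edges F'"
    "a \<in> face_edges F" "a \<in> face_edges fo" "v \<in> a" "a' \<in> face_edges F'" "a' \<in> face_edges fo" "v \<in> a'"
    "a \<noteq> a'" "\<And>e. e \<in> E \<Longrightarrow> v \<in> e \<Longrightarrow> e = s \<or> e = a \<or> e = a'"
proof -
  have sE: "s \<in> E" using s(1) by (simp add: S_def)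
  obtain w where w: "s = {v, w}" "(v, w) \<in> D" by (rule edge_at[OF sE s(2)])
  define F F' where "F = orb (v, w)" and "F' = orb (w, v)"
  have F: "F \<in> IF" "F' \<in> IF" and ne: "F \<noteq> F'"
    using S_dart[of v w] s(1) w no_loop[of v w] by (simp_all add: F_def F'_def)
  have FF: "F \<in> FS" "F' \<in> FS" using F IF_FS by blast+
  have d: "(v, w) \<in> F" "(w, v) \<in> F'" using orb_self by (simp_all add: F_def F'_def)
  have sF: "s \<in> face_edges F" "s \<in> face_edges F'" using d w(1) by (simp_all add: face_edges_iff)
  obtain b where b: "(b, v) \<in> F" by (rule face_in_dart[OF FF(1) d(1)])
  define b' where "b' = rot v w"
  have b': "(v, b') \<in> F'" using face_out_dart[OF FF(2) d(2)] by (simp add: b'_def)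
  define a a' where "a = {v, b}" and "a' = {v, b'}"
  have aF: "a \<in> face_edges F" "a' \<in> face_edges F'"
    using b b' by (simp_all add: a_def a'_def face_edges_iff)
  have bw: "b \<noteq> w" using face_no_rev[OF FF(1) d(1)] b by auto
  have bw': "b' \<noteq> w" using face_no_rev[OF FF(2) d(2)] b' by auto
  have vab: "v \<in> a" "v \<in> a'" by (simp_all add: a_def a'_def)
  have "a \<noteq> s" "a' \<noteq> s" using bw bw' by (auto simp: a_def a'_def w(1) doubleton_eq_iff)
  then have nS: "a \<notin> S" "a' \<notin> S" using S_unique[OF _ s(1) vab(1) s(2)] S_unique[OF _ s(1) vab(2) s(2)] by blast+
  have aE: "a \<in> E" "a' \<in> E" using face_edges_sub FF aF by blast+
  then have afo: "a \<in> face_edges fo" "a' \<in> face_edges fo" using nS by (simp_all add: S_def)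
  have aa: "a \<noteq> a'" using S_if_two_inner[OF F ne aF(1)] aF(2) nS(1) by auto
  then have bb: "b \<noteq> b'" by (auto simp: a_def a'_def)
  have D: "(v, w) \<in> D" "(v, b) \<in> D" "(v, b') \<in> D" using w(2) aE dart_iff by (simp_all add: a_def a'_def)
  have vV: "v \<in> V" using edgeD[of v w] sE w(1) by simp
  have only: "e = s \<or> e = a \<or> e = a'" if e: "e \<in> E" "v \<in> e" for e
  proof (rule ccontr)
    assume no: "\<not> ?thesis"
    obtain x where x: "e = {v, x}" "(v, x) \<in> D" by (rule edge_at[OF e])
    then have "length [w, b, b', x] \<le> 3"
      using no D bw bw' bb by (intro nbrs_le[OF vV]) (auto simp: nbr_iff a_def a'_def w(1))
    then show False by simp
  qed
  show ?thesis by (rule that[OF F ne sF aF(1) afo(1) vab(1) aF(2) afo(2) vab(2) aa only])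
qed

text \<open>All edges at v are outer, the outer face has only two edges there, and F already has
  two; so these are the same edges.\<close>

lemma at_unshared_vertex:
  assumes v: "v \<in> V" and no: "\<And>s. s \<in> S \<Longrightarrow> v \<notin> s"
  obtains F where "F \<in> IF" "v \<in> face_vertices F"
    "\<And>e. e \<in> E \<Longrightarrow> v \<in> e \<Longrightarrow> e \<in> face_edges F \<and> e \<in> face_edges fo"
proof -
  obtain F where F: "F \<in> IF" "v \<in> face_vertices F" by (rule vertex_in_inner[OF v])
  have FF: "F \<in> FS" using F IF_FS by blast
  have outer: "e \<in> face_edges fo" if "e \<in> E" "v \<in> e" for e
    using no[of e] that by (auto simp: S_def)
  obtain a b where ab: "(v, a) \<in> F" "(b, v) \<in> F" "a \<noteq> b" by (rule face_at[OF FF F(2)]) blast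
  have fe: "{v, a} \<in> face_edges F" "{b, v} \<in> face_edges F" using ab by (auto simp: face_edges_iff)
  have ne: "{v, a} \<noteq> {b, v}" using ab(3) by (auto simp: doubleton_eq_iff)
  have fE: "{v, a} \<in> E" "{b, v} \<in> E" using fe face_edges_sub[OF FF] by blast+
  obtain p q where pq: "\<And>e. e \<in> face_edges fo \<Longrightarrow> v \<in> e \<Longrightarrow> e = {v, p} \<or> e = {q, v}"
    by (rule face_at[OF fo_FS on_outer[OF v]]) blast
  have "e \<in> face_edges F" if e: "e \<in> E" "v \<in> e" for e
  proof -
    \<comment> \<open>Pigeonhole: three members of a pair, two of them different, leave the third no
      new value.\<close>
    have pick: "x = y \<or> x = z" if "x = P \<or> x = Q" "y = P \<or> y = Q" "z = P \<or> z = Q" "y \<noteq> z"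
      for x y z P Q :: "'v set" using that by blast
    have "e = {v, a} \<or> e = {b, v}"
      by (rule pick[OF pq[OF outer[OF e] e(2)] pq[OF outer[OF fE(1)]] pq[OF outer[OF fE(2)]] ne])
        simp_all
    then show ?thesis using fe by blast
  qed
  then show ?thesis using that[OF F] outer by blast
qed

end

section \<open>Perfect matchings as independent sets of the inner dual\<close>

text \<open>\<open>cc F\<close> is the index of the class containing the shared edges of F; it is
  arbitrary if F has none.\<close>

locale regular_cers = cers V E rot fo
  for V :: "'v set" and E :: "'v set set" and rot :: "'v \<Rightarrow> 'v \<Rightarrow> 'v" and fo :: "('v \<times> 'v) set" +
  fixes cc :: "('v \<times> 'v) set \<Rightarrow> bool"
  assumes cc: "\<And>F e. F \<in> IF \<Longrightarrow> e \<in> face_edges F \<Longrightarrow> e \<in> S \<Longrightarrow> e \<in> cls F (cc F)"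
begin

definition indep :: "('v \<times> 'v) set set \<Rightarrow> bool" where
  "indep I \<longleftrightarrow> I \<subseteq> IF \<and> (\<forall>F\<in>I. \<forall>F'\<in>I. \<not> inner_dual_adj E rot fo F F')"

text \<open>The class of F avoiding all shared edges is the one with index \<open>\<not> cc F\<close>; it is contained in the
  matching for F in I, and the other class, up to shared edges covered from a neighbouring face, for
  F not in I.\<close>
definition matching_of :: "('v \<times> 'v) set set \<Rightarrow> 'v set set" where
  "matching_of I = {e \<in> E. \<forall>F\<in>IF. e \<in> face_edges F \<longrightarrow> (F \<in> I \<longleftrightarrow> e \<notin> cls F (cc F))}"

lemma matching_of_outer:
  assumes "F \<in> IF" "x \<in> face_edges F" "x \<in> face_edges fo"
  shows "x \<in> matching_of I \<longleftrightarrow> (F \<in> I \<longleftrightarrow> x \<notin> cls F (cc F))"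
proof -
  have "x \<in> E" using face_edges_sub[OF IF_FS[OF assms(1)]] assms(2) by blast
  moreover have "F' = F" if "F' \<in> IF" "x \<in> face_edges F'" for F'
    using outer_edge_unique[OF assms(1) that(1) assms(2,3) that(2)] .
  ultimately show ?thesis using assms(1,2) unfolding matching_of_def by blast
qed

text \<open>By \<open>cc\<close> the edge is in the distinguished class of both its faces, so each
  of them demands its own absence from I.\<close>

lemma matching_of_shared:
  assumes F: "F \<in> IF" "F' \<in> IF" "F \<noteq> F'" and e: "e \<in> face_edges F" "e \<in> face_edges F'"
  shows "e \<in> matching_of I \<longleftrightarrow> F \<notin> I \<and> F' \<notin> I"
proof -
  have FF: "F \<in> FS" "F' \<in> FS" using F IF_FS by blast+
  have S: "e \<in> S" using S_if_two_inner[OF F e] .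
  have "G = F \<or> G = F'" if "G \<in> IF" "e \<in> face_edges G" for G
    using inc_two[of F e F' G] F e FF that IF_FS[of G] by (auto simp: inc_def)
  moreover have "e \<in> cls F (cc F)" "e \<in> cls F' (cc F')" using cc F e S by blast+
  moreover have "e \<in> E" using S by (simp add: S_def)
  ultimately show ?thesis using F e unfolding matching_of_def by blast
qed

lemma indep_shared:
  assumes "indep I" "F \<in> IF" "F' \<in> IF" "F \<noteq> F'" "e \<in> face_edges F" "e \<in> face_edges F'"
  shows "\<not> (F \<in> I \<and> F' \<in> I)"
  using assms unfolding indep_def inner_dual_adj_def by blast

text \<open>At an end of a shared edge, the two outer edges are selected by F \<in> I and F' \<in>
  I, and the shared edge by neither; independence excludes that both outer edges are taken. At any
  other vertex the selected edges are those of one class of F.\<close>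

lemma matching_of_PM:
  assumes I: "indep I" shows "matching_of I \<in> PM"
  unfolding PM_iff
proof (intro conjI ballI)
  show "matching_of I \<subseteq> E" unfolding matching_of_def by blast
  fix v assume v: "v \<in> V"
  show "\<exists>!e. e \<in> matching_of I \<and> v \<in> e"
  proof (cases "\<exists>s\<in>S. v \<in> s")
    case True
    then obtain s where s: "s \<in> S" "v \<in> s" by blast
    obtain F F' a a' where F: "F \<in> IF" "F' \<in> IF" "F \<noteq> F'" and sF: "s \<in> face_edges F" "s \<in> face_edges F'"
      and a: "a \<in> face_edges F" "a \<in> face_edges fo" "v \<in> a"
      and a': "a' \<in> face_edges F'" "a' \<in> face_edges fo" "v \<in> a'" and ne: "a \<noteq> a'"
      and only: "\<And>e. e \<in> E \<Longrightarrow> v \<in> e \<Longrightarrow> e = s \<or> e = a \<or> e = a'"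
      by (rule at_shared_vertex[OF s]) blast
    have as: "a \<noteq> s" "a' \<noteq> s" using a(2) a'(2) s(1) by (auto simp: S_def)
    have "a \<notin> cls F (cc F)"
      using cls_unique[OF IF_FS[OF F(1)] _ cc[OF F(1) sF(1) s(1)] a(3) s(2)] as(1) by blast
    then have aM: "a \<in> matching_of I \<longleftrightarrow> F \<in> I" using matching_of_outer[OF F(1) a(1,2)] by blast
    have "a' \<notin> cls F' (cc F')"
      using cls_unique[OF IF_FS[OF F(2)] _ cc[OF F(2) sF(2) s(1)] a'(3) s(2)] as(2) by blast
    then have a'M: "a' \<in> matching_of I \<longleftrightarrow> F' \<in> I" using matching_of_outer[OF F(2) a'(1,2)] by blast
    have sM: "s \<in> matching_of I \<longleftrightarrow> F \<notin> I \<and> F' \<notin> I" by (rule matching_of_shared[OF F sF])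
    have nI: "\<not> (F \<in> I \<and> F' \<in> I)" by (rule indep_shared[OF I F sF])
    have only': "e = s \<or> e = a \<or> e = a'" if "e \<in> matching_of I" "v \<in> e" for e
      using only that unfolding matching_of_def by blast
    consider "F \<in> I" "F' \<notin> I" | "F \<notin> I" "F' \<in> I" | "F \<notin> I" "F' \<notin> I" using nI by blast
    then show ?thesis
    proof cases
      case 1
      then show ?thesis using aM a'M sM only' a(3) by (intro ex1I[of _ a]) blast+
    next
      case 2
      then show ?thesis using aM a'M sM only' a'(3) by (intro ex1I[of _ a']) blast+
    next
      case 3
      then show ?thesis using aM a'M sM only' s(2) by (intro ex1I[of _ s]) blast+
    qed
  next
    case False
    obtain F where F: "F \<in> IF" "v \<in> face_vertices F"
      and only: "\<And>e. e \<in> E \<Longrightarrow> v \<in> e \<Longrightarrow> e \<in> face_edges F \<and> e \<in> face_edges fo"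
      by (rule at_unshared_vertex[OF v]) (use False in blast)+
    have FF: "F \<in> FS" using F IF_FS by blast
    have "e \<in> matching_of I \<and> v \<in> e \<longleftrightarrow> e \<in> cls F (if F \<in> I then \<not> cc F else cc F) \<and> v \<in> e" for e
    proof (cases "e \<in> E \<and> v \<in> e")
      case True
      then have e: "e \<in> face_edges F" "e \<in> face_edges fo" using only by blast+
      show ?thesis using matching_of_outer[OF F(1) e] cls_compl[OF FF e(1), of "cc F"] by simp
    next
      case False
      then show ?thesis using cls_sub face_edges_sub[OF FF] unfolding matching_of_def by blast
    qed
    then show ?thesis using cls_ex1[OF FF F(2)] by simp
  qed
qed

text \<open>\<open>matching_of {}\<close> plays the role of the bottom vertex, and a face is
  recorded if M differs from it on an outer edge of that face. By \<open>outer_edges_agree\<close>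
  it does not matter which outer edge is tested.\<close>

definition faces_of :: "'v set set \<Rightarrow> ('v \<times> 'v) set set" where
  "faces_of M = {F \<in> IF. \<exists>x\<in>face_edges F \<inter> face_edges fo. (x \<in> M) \<noteq> (x \<in> matching_of {})}"

lemma indep_empty: "indep {}" by (simp add: indep_def)

lemma faces_of_outer:
  assumes "M \<in> PM" "F \<in> IF" "x \<in> face_edges F" "x \<in> face_edges fo"
  shows "F \<in> faces_of M \<longleftrightarrow> (x \<in> M) \<noteq> (x \<in> matching_of {})"
  using outer_edges_agree[OF assms(1) matching_of_PM[OF indep_empty] assms(2-4)] assms(2-4)
  unfolding faces_of_def by blast

lemma outer_iff:
  assumes "M \<in> PM" "F \<in> IF" "x \<in> face_edges F" "x \<in> face_edges fo"
  shows "x \<in> M \<longleftrightarrow> x \<in> matching_of (faces_of M)"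
  using faces_of_outer[OF assms] matching_of_outer[OF assms(2-4)] by blast

text \<open>If two adjacent faces were both recorded, M would contain the outer edges of both at an
  end of their shared edge.\<close>

lemma faces_of_indep:
  assumes M: "M \<in> PM" shows "indep (faces_of M)"
  unfolding indep_def
proof (intro conjI ballI)
  show "faces_of M \<subseteq> IF" unfolding faces_of_def by blast
  fix G G' assume G: "G \<in> faces_of M" "G' \<in> faces_of M"
  show "\<not> inner_dual_adj E rot fo G G'"
  proof
    assume "inner_dual_adj E rot fo G G'"
    then obtain s where GI: "G \<in> IF" "G' \<in> IF" "G \<noteq> G'" and sG: "s \<in> face_edges G" "s \<in> face_edges G'"
      unfolding inner_dual_adj_def by blast
    have s: "s \<in> S" using S_if_two_inner[OF GI sG] .
    have "s \<in> E" using s by (simp add: S_def)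
    then obtain v where v: "v \<in> s" using edgeE[of s] by blast
    obtain F F' a a' where F: "F \<in> IF" "F' \<in> IF" "F \<noteq> F'" and sF: "s \<in> face_edges F" "s \<in> face_edges F'"
      and a: "a \<in> face_edges F" "a \<in> face_edges fo" "v \<in> a"
      and a': "a' \<in> face_edges F'" "a' \<in> face_edges fo" "v \<in> a'" and ne: "a \<noteq> a'"
      by (rule at_shared_vertex[OF s v]) blast
    have "F = G \<or> F = G'" "F' = G \<or> F' = G'"
      using inc_two[of G s G' F] inc_two[of G s G' F'] GI sG F sF IF_FS by (auto simp: inc_def)
    then have FI: "F \<in> faces_of M" "F' \<in> faces_of M" using G by blast+
    have as: "a \<noteq> s" "a' \<noteq> s" using a(2) a'(2) s(1) by (auto simp: S_def)
    have "a \<notin> cls F (cc F)"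
      using cls_unique[OF IF_FS[OF F(1)] _ cc[OF F(1) sF(1) s] a(3) v] as(1) by blast
    then have "a \<in> M"
      using matching_of_outer[OF F(1) a(1,2)] outer_iff[OF M F(1) a(1,2)] FI by blast
    moreover have "a' \<notin> cls F' (cc F')"
      using cls_unique[OF IF_FS[OF F(2)] _ cc[OF F(2) sF(2) s] a'(3) v] as(2) by blast
    then have "a' \<in> M"
      using matching_of_outer[OF F(2) a'(1,2)] outer_iff[OF M F(2) a'(1,2)] FI by blast
    ultimately show False using PM_unique[OF M _ _ a(3) a'(3)] ne by blast
  qed
qed

text \<open>A perfect matching is determined by its outer edges: it contains a shared edge exactly
  when it contains neither of the two outer edges at an end of it.\<close>

lemma matching_of_faces_of:
  assumes M: "M \<in> PM" shows "matching_of (faces_of M) = M"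
proof -
  define N where "N = matching_of (faces_of M)"
  have N: "N \<in> PM" unfolding N_def by (rule matching_of_PM[OF faces_of_indep[OF M]])
  have same: "x \<in> M \<longleftrightarrow> x \<in> N" if "F \<in> IF" "x \<in> face_edges F" "x \<in> face_edges fo" for F x
    unfolding N_def by (rule outer_iff[OF M that])
  have "e \<in> M \<longleftrightarrow> e \<in> N" if eE: "e \<in> E" for e
  proof (cases "e \<in> face_edges fo")
    case True
    obtain F where "F \<in> IF" "e \<in> face_edges F" by (rule edge_in_inner[OF eE])
    then show ?thesis using same True by blast
  next
    case False
    then have s: "e \<in> S" using eE by (simp add: S_def)
    obtain v where v: "v \<in> e" "v \<in> V" using edgeE[OF eE] by blast
    obtain F F' a a' where F: "F \<in> IF" "F' \<in> IF"
      and a: "a \<in> face_edges F" "a \<in> face_edges fo" "v \<in> a"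
      and a': "a' \<in> face_edges F'" "a' \<in> face_edges fo" "v \<in> a'"
      and only: "\<And>x. x \<in> E \<Longrightarrow> v \<in> x \<Longrightarrow> x = e \<or> x = a \<or> x = a'"
      by (rule at_shared_vertex[OF s v(1)]) blast
    have ea: "e \<noteq> a" "e \<noteq> a'" using a(2) a'(2) False by auto
    have key: "e \<in> K \<longleftrightarrow> a \<notin> K \<and> a' \<notin> K" if K: "K \<in> PM" for K
    proof
      assume "e \<in> K"
      then show "a \<notin> K \<and> a' \<notin> K" using PM_unique[OF K _ _ v(1)] a(3) a'(3) ea by blast
    next
      assume no: "a \<notin> K \<and> a' \<notin> K"
      obtain x where x: "x \<in> K" "v \<in> x" using K v(2) unfolding PM_iff by blast
      have "x \<in> E" using x K unfolding PM_iff by blast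
      then show "e \<in> K" using only x no by blast
    qed
    show ?thesis using key[OF M] key[OF N] same[OF F(1) a(1,2)] same[OF F(2) a'(1,2)] by blast
  qed
  moreover have "M \<subseteq> E" "N \<subseteq> E" using M N PM_iff by blast+
  ultimately show ?thesis unfolding N_def[symmetric] by blast
qed

lemma faces_of_matching_of:
  assumes I: "indep I" shows "faces_of (matching_of I) = I"
proof -
  have "F \<in> faces_of (matching_of I) \<longleftrightarrow> F \<in> I" if F: "F \<in> IF" for F
  proof -
    obtain x where x: "x \<in> face_edges F" "x \<in> face_edges fo" by (rule outer_edge_exists[OF F])
    show ?thesis
      using faces_of_outer[OF matching_of_PM[OF I] F x] matching_of_outer[OF F x] by blast
  qed
  moreover have "faces_of (matching_of I) \<subseteq> IF" "I \<subseteq> IF"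
    using I unfolding faces_of_def indep_def by blast+
  ultimately show ?thesis by blast
qed

text \<open>From left to right, an outer edge of G is flipped only if it lies on F, that is, if G =
  F. Conversely, the edges off F see no change, and those on F are switched by F alone.\<close>

lemma flip_iff:
  assumes M: "M \<in> PM" "M' \<in> PM" and F: "F \<in> IF"
  shows "(M - M') \<union> (M' - M) = face_edges F \<longleftrightarrow>
    (\<forall>G\<in>IF. (G \<in> faces_of M) \<noteq> (G \<in> faces_of M') \<longleftrightarrow> G = F)"
proof
  assume sd: "(M - M') \<union> (M' - M) = face_edges F"
  show "\<forall>G\<in>IF. (G \<in> faces_of M) \<noteq> (G \<in> faces_of M') \<longleftrightarrow> G = F"
  proof
    fix G assume G: "G \<in> IF"
    obtain x where x: "x \<in> face_edges G" "x \<in> face_edges fo" by (rule outer_edge_exists[OF G])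
    have "(G \<in> faces_of M) \<noteq> (G \<in> faces_of M') \<longleftrightarrow> (x \<in> M) \<noteq> (x \<in> M')"
      using faces_of_outer[OF M(1) G x] faces_of_outer[OF M(2) G x] by blast
    also have "\<dots> \<longleftrightarrow> x \<in> face_edges F" unfolding sd[symmetric] by blast
    also have "\<dots> \<longleftrightarrow> G = F" using outer_edge_unique[OF G F x] x(1) by blast
    finally show "(G \<in> faces_of M) \<noteq> (G \<in> faces_of M') \<longleftrightarrow> G = F" .
  qed
next
  assume diff: "\<forall>G\<in>IF. (G \<in> faces_of M) \<noteq> (G \<in> faces_of M') \<longleftrightarrow> G = F"
  define I I' where "I = faces_of M" and "I' = faces_of M'"
  have MI: "M = matching_of I" "M' = matching_of I'" and ind: "indep I" "indep I'"
    using M matching_of_faces_of faces_of_indep by (simp_all add: I_def I'_def)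
  have other: "G \<in> I \<longleftrightarrow> G \<in> I'" if "G \<in> IF" "G \<noteq> F" for G
    using diff that unfolding I_def I'_def by blast
  have self: "F \<in> I \<longleftrightarrow> F \<notin> I'" using diff F unfolding I_def I'_def by blast
  have "(e \<in> M) \<noteq> (e \<in> M') \<longleftrightarrow> e \<in> face_edges F" if eE: "e \<in> E" for e
  proof (cases "e \<in> face_edges F")
    case False
    then have "G \<in> I \<longleftrightarrow> G \<in> I'" if "G \<in> IF" "e \<in> face_edges G" for G using other that by blast
    then have "e \<in> matching_of I \<longleftrightarrow> e \<in> matching_of I'" unfolding matching_of_def by blast
    then show ?thesis using False MI by simp
  next
    case True
    show ?thesis
    proof (cases "e \<in> face_edges fo")
      case outer: True
      show ?thesis using matching_of_outer[OF F True outer, of I] matching_of_outer[OF F True outer, of I']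
          self True unfolding MI by blast
    next
      case False
      then have "e \<in> S" using eE by (simp add: S_def)
      then obtain G where G: "G \<in> IF" "G \<noteq> F" "e \<in> face_edges G" by (rule S_other[OF _ F True])
      \<comment> \<open>F lies in one of I and I', so by independence G is absent from that one, and
        hence from both as F is the only difference. The shared edge then depends on F
        alone.\<close>
      have "\<not> (F \<in> J \<and> G \<in> J)" if "indep J" for J
        by (rule indep_shared[OF that F G(1) G(2)[symmetric] True G(3)])
      then have "G \<notin> I" "G \<notin> I'" using other[OF G(1,2)] self ind by blast+
      then show ?thesis
        using matching_of_shared[OF F G(1) G(2)[symmetric] True G(3), of I]
          matching_of_shared[OF F G(1) G(2)[symmetric] True G(3), of I'] self True
        unfolding MI by blast
    qed
  qed
  moreover have "M \<subseteq> E" "M' \<subseteq> E" "face_edges F \<subseteq> E"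
    using M PM_iff face_edges_sub[OF IF_FS[OF F]] by blast+
  ultimately show "(M - M') \<union> (M' - M) = face_edges F" by blast
qed

text \<open>A matching is encoded by the indicator vector of its recorded faces. Taking the codes of
  all independent sets as X makes X closed downwards, so \<open>daisy_vertices n X\<close> is X
  itself, and by \<open>flip_iff\<close> a flip is a change of one coordinate.\<close>

lemma daisy: "daisy_cube PM (resonance_adj V E rot fo)"
proof -
  have "finite IF" using finite_FS by (simp add: inner_faces_def)
  then obtain fs where fs: "set fs = IF" "distinct fs" using finite_distinct_list by metis
  define code where "code I = map (\<lambda>F. F \<in> I) fs" for I
  define f where "f M = code (faces_of M)" for M
  define n where "n = length fs"
  define X where "X = code ` {I. indep I}"
  have len: "length (code I) = n" for I by (simp add: code_def n_def)
  have down: "u \<in> X" if u: "u \<in> daisy_vertices n X" for u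
  proof -
    obtain J where J: "indep J" "length u = n" "\<forall>i<n. u ! i \<longrightarrow> code J ! i"
      using u unfolding daisy_vertices_def X_def bvec_le_def by auto
    define I where "I = {fs ! i | i. i < n \<and> u ! i}"
    have "I \<subseteq> J" using J(3) by (auto simp: I_def code_def n_def)
    then have "indep I" using J(1) unfolding indep_def by blast
    moreover have "u = code I"
    proof (rule nth_equalityI)
      fix i assume i: "i < length u"
      have "fs ! i \<in> I \<longleftrightarrow> u ! i"
        using i J(2) fs(2) by (auto simp: I_def n_def nth_eq_iff_index_eq)
      then show "u ! i = code I ! i" using i J(2) by (simp add: code_def n_def)
    qed (simp add: len J(2))
    ultimately show ?thesis unfolding X_def by blast
  qed
  have DV: "daisy_vertices n X = X"
  proof
    show "daisy_vertices n X \<subseteq> X" using down by blast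
    show "X \<subseteq> daisy_vertices n X"
      unfolding daisy_vertices_def X_def bvec_le_def using len by auto
  qed
  have code_inj: "I = J" if "code I = code J" "I \<subseteq> IF" "J \<subseteq> IF" for I J
    using that fs(1) by (auto simp: code_def)
  have sub: "faces_of M \<subseteq> IF" for M unfolding faces_of_def by blast
  have "inj_on f PM"
  proof (rule inj_onI)
    fix M M' assume M: "M \<in> PM" "M' \<in> PM" and "f M = f M'"
    then have "faces_of M = faces_of M'" using code_inj sub unfolding f_def by blast
    then show "M = M'" using matching_of_faces_of M by metis
  qed
  moreover have "f ` PM = X"
  proof
    show "f ` PM \<subseteq> X" using faces_of_indep unfolding f_def X_def by blast
    show "X \<subseteq> f ` PM"
    proof
      fix u assume "u \<in> X"
      then obtain I where I: "indep I" "u = code I" unfolding X_def by blast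
      then have "u = f (matching_of I)" using faces_of_matching_of by (simp add: f_def)
      then show "u \<in> f ` PM" using matching_of_PM[OF I(1)] by blast
    qed
  qed
  ultimately have bij: "bij_betw f PM (daisy_vertices n X)" unfolding DV bij_betw_def by blast
  have adj: "resonance_adj V E rot fo M M' \<longleftrightarrow> hypercube_adj (f M) (f M')"
    if M: "M \<in> PM" "M' \<in> PM" for M M'
  proof -
    define P where "P F \<longleftrightarrow> (\<forall>G\<in>IF. (G \<in> faces_of M) \<noteq> (G \<in> faces_of M') \<longleftrightarrow> G = F)" for F
    define Di where "Di = {i. i < n \<and> (fs ! i \<in> faces_of M) \<noteq> (fs ! i \<in> faces_of M')}"
    have "{i. i < length (f M) \<and> f M ! i \<noteq> f M' ! i} = Di"
      by (auto simp: f_def code_def n_def Di_def)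
    then have "hypercube_adj (f M) (f M') \<longleftrightarrow> (\<exists>i. Di = {i})"
      by (simp add: hypercube_adj_def f_def len card_1_singleton_iff)
    also have "\<dots> \<longleftrightarrow> (\<exists>i<n. P (fs ! i))"
    proof -
      have "Di = {i} \<longleftrightarrow> P (fs ! i)" if i: "i < n" for i
      proof -
        have "Di = {i} \<longleftrightarrow> (\<forall>j<n. (fs ! j \<in> faces_of M) \<noteq> (fs ! j \<in> faces_of M') \<longleftrightarrow> j = i)"
          using i unfolding Di_def by blast
        also have "\<dots> \<longleftrightarrow> (\<forall>j<n. (fs ! j \<in> faces_of M) \<noteq> (fs ! j \<in> faces_of M') \<longleftrightarrow> fs ! j = fs ! i)"
          using i fs(2) by (simp add: n_def nth_eq_iff_index_eq)
        also have "\<dots> \<longleftrightarrow> P (fs ! i)"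
          unfolding P_def fs(1)[symmetric] all_set_conv_all_nth n_def by blast
        finally show ?thesis .
      qed
      moreover have "i < n" if "Di = {i}" for i using that unfolding Di_def by blast
      ultimately have "(\<exists>i. Di = {i}) \<longleftrightarrow> (\<exists>i. i < n \<and> P (fs ! i))" by blast
      then show ?thesis by simp
    qed
    also have "\<dots> \<longleftrightarrow> (\<exists>F\<in>IF. P F)"
      unfolding fs(1)[symmetric] n_def by (metis in_set_conv_nth)
    also have "\<dots> \<longleftrightarrow> (\<exists>F\<in>IF. (M - M') \<union> (M' - M) = face_edges F)"
      using flip_iff[OF M] by (simp add: P_def)
    also have "\<dots> \<longleftrightarrow> resonance_adj V E rot fo M M'"
      using M by (simp add: resonance_adj_def)
    finally show ?thesis by (rule sym)
  qed
  have "X \<subseteq> {x. length x = n}" unfolding X_def using len by blast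
  then show ?thesis unfolding daisy_cube_def using bij adj by blast
qed

end

theorem theorem4p2:
  fixes V :: "'v set" and E :: "'v set set" and rot :: "'v \<Rightarrow> 'v \<Rightarrow> 'v"
    and fo :: "('v \<times> 'v) set"
  assumes "CERS V E rot fo"
  shows "regular_CERS V E rot fo \<longleftrightarrow>
         daisy_cube (perfect_matchings V E) (resonance_adj V E rot fo)"
proof -
  have "plane_graph V E rot fo" using assms by (simp add: CERS_def even_ring_system_def)
  then interpret cers V E rot fo
    using assms by unfold_locales (simp_all add: plane_graph_def)
  show ?thesis
  proof
    assume "regular_CERS V E rot fo"
    then obtain cc where "\<And>F e. F \<in> IF \<Longrightarrow> e \<in> face_edges F \<inter> S \<Longrightarrow> e \<in> cls F (cc F)"
      using regular_shared_cls by metis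
    then interpret regular_cers V E rot fo cc by unfold_locales blast
    show "daisy_cube (perfect_matchings V E) (resonance_adj V E rot fo)" by (rule daisy)
  qed (rule regular_if_daisy)
qed

end
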